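(* Let $\Omega$ be a proper convex open domain in $\mathbb{RP}^n$, let $d^H$ be its Hilbert distance and $d^B$ its Blaschke distance (the distance associated to the Blaschke metric $h^B$ of $\Omega$). Then for any $x,y\in\Omega$, $$d^B(x,y) < d^H(x,y)+1.$$
   Context: An open domain $\Omega\subset\mathbb{RP}^n$ is convex if its intersection with any projective line is connected, and proper if its closure does not contain a projective line. Hilbert distance: the cross-ratio $[x_1,x_2,x_3,x_4]$ of four points on a projective line is the number $t$ such that $(x_1,x_2,x_3,x_4)$ is sent to $(0,1,\infty,t)$ in some affine chart of the line. For $x,y\in\Omega$, let $a,b$ be the two intersection points of the projective line through $x$ and $y$ with $\partial\Omega$, with $x$ between $a$ and $y$; then $d^H(x,y)=\frac12\log|[a,x,b,y]|$ (and $d^H(x,x)=0$). Blaschke metric: let $L$ be the restriction to $\Omega$ of the tautological real line bundle over $\mathbb{RP}^n$, and let $\xi$ be a smooth nowhere vanishing section of $L$, so that $\xi(\Omega)$ is a smooth hypersurface in $\mathbb{R}^{n+1}$ transverse to the radial vector field. Let $E$ be the pull-back of the tangent bundle of $\mathbb{R}^{n+1}$ by $\xi$; then $E=T\Omega\oplus L$, where $T\Omega$ is identified with its image under $d\xi$. Let $\nabla$ be the flat connection on $E$ induced from $\mathbb{R}^{n+1}$ and $\omega$ the volume form induced by a fixed volume form on $\mathbb{R}^{n+1}$. For vector fields $X,Y$ on $\Omega$ write $\nabla_XY=\nabla^\xi_XY+h(X,Y)\xi$, with $\nabla^\xi$ a connection on $T\Omega$ and $h$ a symmetric bilinear form. The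 hypersurface is strictly convex if $h$ is positive definite, and proper if $\xi:\Omega\to\mathbb{R}^{n+1}$ is proper. If it is strictly convex, extend $h$ to a metric $\hat h$ on $E$ such that $T\Omega\oplus L$ is orthogonal and $\xi(x)\in L_x$ has norm $1$. The hypersurface $\xi(\Omega)$ is a hyperbolic affine sphere asymptotic to $\Omega$ if it is proper, strictly convex, and $\omega$ gives volume $1$ to oriented orthonormal bases of $\hat h$. By a theorem of Cheng and Yau there is a unique such affine sphere (up to the sign of $\xi$); the corresponding Riemannian metric $h$ on $\Omega$ is the Blaschke metric $h^B$ and does not depend on the chosen volume form. *)

theory Defs
  imports "HOL-Analysis.Analysis"
begin

section \<open>Real projective space\<close>

text \<open>
  A point of \<open>'m rp\<close> is a line through the origin in \<open>real ^ 'm\<close>, so that \<open>'m rp\<close> is the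
  projective space of dimension \<open>CARD('m) - 1\<close>, and \<open>line_of x\<close> is the fibre over \<open>x\<close> of the
  tautological line bundle. The topology is the quotient topology.
\<close>

typedef ('m::finite) rp = "{L :: (real ^ 'm) set. subspace L \<and> dim L = 1}"
  morphisms line_of Abs_rp
proof
  show "span {axis undefined 1 :: real ^ 'm} \<in> {L. subspace L \<and> dim L = 1}"
    by (simp add: dim_span dim_singleton axis_eq_0_iff)
qed

text \<open>\<open>proj\<close> is only meaningful on nonzero vectors.\<close>

definition proj :: "real ^ 'm::finite \<Rightarrow> 'm rp"
  where "proj v = Abs_rp (span {v})"

lemma line_of_proj: "v \<noteq> 0 \<Longrightarrow> line_of (proj v) = span {v}"
  unfolding proj_def by (rule Abs_rp_inverse) (simp add: dim_span dim_singleton)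

definition cone :: "'m::finite rp set \<Rightarrow> (real ^ 'm) set"
  where "cone U = {v. v \<noteq> 0 \<and> proj v \<in> U}"

instantiation rp :: (finite) topological_space
begin

definition open_rp :: "'a rp set \<Rightarrow> bool"
  where "open_rp U \<longleftrightarrow> open (cone U)"

instance
proof
  have "cone (UNIV :: 'a rp set) = - {0}"
    by (auto simp: cone_def)
  then show "open (UNIV :: 'a rp set)"
    by (simp add: open_rp_def open_Compl)
next
  fix S T :: "'a rp set"
  assume "open S" "open T"
  moreover have "cone (S \<inter> T) = cone S \<inter> cone T"
    by (auto simp: cone_def)
  ultimately show "open (S \<inter> T)"
    by (simp add: open_rp_def open_Int)
next
  fix K :: "'a rp set set"
  assume "\<forall>S\<in>K. open S"
  moreover have "cone (\<Union>K) = (\<Union>S\<in>K. cone S)"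
    by (auto simp: cone_def)
  ultimately show "open (\<Union>K)"
    by (simp add: open_rp_def open_UN)
qed

end

definition proj_line :: "'m::finite rp set \<Rightarrow> bool"
  where "proj_line l \<longleftrightarrow> (\<exists>P. subspace P \<and> dim P = 2 \<and> l = {x. line_of x \<subseteq> P})"

definition convex_rp :: "'m::finite rp set \<Rightarrow> bool"
  where "convex_rp \<Omega> \<longleftrightarrow> (\<forall>l. proj_line l \<longrightarrow> connected (\<Omega> \<inter> l))"

definition proper_rp :: "'m::finite rp set \<Rightarrow> bool"
  where "proper_rp \<Omega> \<longleftrightarrow> (\<nexists>l. proj_line l \<and> l \<subseteq> closure \<Omega>)"


section \<open>The Hilbert distance\<close>

text \<open>
  An affine chart of a projective line is \<open>proj (s *\<^sub>R u + w) \<mapsto> s\<close> for a basis \<open>u, w\<close> of the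
  underlying plane; it sends \<open>proj w\<close>, \<open>proj (u + w)\<close>, \<open>proj u\<close> to \<open>0\<close>, \<open>1\<close>, \<open>\<infinity>\<close>.
  The value is only meaningful for collinear points with the first three distinct and the
  fourth different from the third.
\<close>

definition cross_ratio ::
    "'m::finite rp \<Rightarrow> 'm rp \<Rightarrow> 'm rp \<Rightarrow> 'm rp \<Rightarrow> real"
  where "cross_ratio x1 x2 x3 x4 =
    (THE t. \<exists>u w. u \<noteq> 0 \<and> w \<noteq> 0 \<and> proj u \<noteq> proj w \<and>
       x1 = proj w \<and> x2 = proj (u + w) \<and> x3 = proj u \<and> x4 = proj (t *\<^sub>R u + w))"

text \<open>
  Two distinct points of a projective line bound two open segments; betweenness refers to the
  one contained in \<open>\<Omega>\<close>.
\<close>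

definition between_in ::
    "'m::finite rp set \<Rightarrow> 'm rp \<Rightarrow> 'm rp \<Rightarrow> 'm rp \<Rightarrow> bool"
  where "between_in \<Omega> a x y \<longleftrightarrow>
    (\<exists>u w. u \<noteq> 0 \<and> w \<noteq> 0 \<and> proj u \<noteq> proj w \<and> a = proj u \<and> y = proj w \<and>
       (\<forall>s>0. \<forall>t>0. proj (s *\<^sub>R u + t *\<^sub>R w) \<in> \<Omega>) \<and>
       (\<exists>s>0. \<exists>t>0. x = proj (s *\<^sub>R u + t *\<^sub>R w)))"

definition hilbert_dist :: "'m::finite rp set \<Rightarrow> 'm rp \<Rightarrow> 'm rp \<Rightarrow> real"
  where "hilbert_dist \<Omega> x y =
    (if x = y then 0
     else (THE d. \<exists>l a b. proj_line l \<and> x \<in> l \<and> y \<in> l \<and> a \<noteq> b \<and>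
             l \<inter> frontier \<Omega> = {a, b} \<and> between_in \<Omega> a x y \<and>
             d = 1 / 2 * ln \<bar>cross_ratio a x b y\<bar>))"


section \<open>Calculus on open subsets of projective space\<close>

text \<open>\<open>C\<^sup>k\<close> regularity on an open set.\<close>

primrec Ck_on ::
    "nat \<Rightarrow> 'a::real_normed_vector set \<Rightarrow> ('a \<Rightarrow> 'b::real_normed_vector) \<Rightarrow> bool"
  where
    "Ck_on 0 S f \<longleftrightarrow> continuous_on S f"
  | "Ck_on (Suc k) S f \<longleftrightarrow> (\<forall>x\<in>S. f differentiable (at x)) \<and>
       (\<forall>a. Ck_on k S (\<lambda>x. frechet_derivative f (at x) a))"

definition smooth_on ::
    "'a::real_normed_vector set \<Rightarrow> ('a \<Rightarrow> 'b::real_normed_vector) \<Rightarrow> bool"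
  where "smooth_on S f \<longleftrightarrow> (\<forall>k. Ck_on k S f)"

text \<open>
  Objects on an open \<open>\<Omega>\<close> are described through the submersion \<open>proj : cone \<Omega> \<rightarrow> \<Omega>\<close>.

  A map on \<open>\<Omega>\<close> is smooth iff its composition with \<open>proj\<close> is. The tangent space of \<open>\<Omega>\<close> at
  \<open>proj v\<close> is the image of \<open>real ^ 'm\<close> under the differential of \<open>proj\<close> at \<open>v\<close>, whose kernel is
  \<open>span {v}\<close>. The differentials at \<open>v\<close> and \<open>t *\<^sub>R v\<close> take the same value on \<open>A\<close> and \<open>t *\<^sub>R A\<close>;
  hence a smooth vector field on \<open>\<Omega>\<close> is given by a smooth vector field on \<open>cone \<Omega>\<close> that is
  homogeneous of degree one (every smooth field on \<open>\<Omega>\<close> has such a lift, for example the one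
  orthogonal to the radial direction).

  A covariant 2-tensor \<open>h\<close> on \<open>\<Omega>\<close> is given by its pull-back under \<open>proj\<close>: \<open>h v A B\<close> is the
  value on the images of \<open>A\<close> and \<open>B\<close> under the differential of \<open>proj\<close> at \<open>v \<in> cone \<Omega>\<close>.
\<close>

type_synonym 'm tensor2 = "real ^ 'm \<Rightarrow> real ^ 'm \<Rightarrow> real ^ 'm \<Rightarrow> real"

definition vector_field :: "'m::finite rp set \<Rightarrow> (real ^ 'm \<Rightarrow> real ^ 'm) \<Rightarrow> bool"
  where "vector_field \<Omega> X \<longleftrightarrow> smooth_on (cone \<Omega>) X \<and>
    (\<forall>v\<in>cone \<Omega>. \<forall>t. t \<noteq> 0 \<longrightarrow> X (t *\<^sub>R v) = t *\<^sub>R X v)"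

text \<open>
  The Riemannian distance. Curves in \<open>\<Omega>\<close> are represented by lifts to \<open>cone \<Omega>\<close>. Using \<open>C\<^sup>1\<close>
  instead of piecewise \<open>C\<^sup>1\<close> curves gives the same lengths, since the curves need not be regular
  and so corners can be reparametrised to have zero velocity.
\<close>

definition curve_length :: "'m::finite tensor2 \<Rightarrow> (real \<Rightarrow> real ^ 'm) \<Rightarrow> real"
  where "curve_length h c = integral {0..1}
    (\<lambda>t. sqrt (h (c t) (vector_derivative c (at t)) (vector_derivative c (at t))))"

definition riemannian_dist ::
    "'m::finite rp set \<Rightarrow> 'm tensor2 \<Rightarrow> 'm rp \<Rightarrow> 'm rp \<Rightarrow> real"
  where "riemannian_dist \<Omega> h x y = Inf {curve_length h c | c.
    c C1_differentiable_on {0..1} \<and> c ` {0..1} \<subseteq> cone \<Omega> \<and> proj (c 0) = x \<and> proj (c 1) = y}"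


section \<open>Affine spheres and the Blaschke metric\<close>

definition nonvanishing_section :: "'m::finite rp set \<Rightarrow> ('m rp \<Rightarrow> real ^ 'm) \<Rightarrow> bool"
  where "nonvanishing_section \<Omega> \<xi> \<longleftrightarrow>
    smooth_on (cone \<Omega>) (\<xi> \<circ> proj) \<and> (\<forall>x\<in>\<Omega>. \<xi> x \<in> line_of x \<and> \<xi> x \<noteq> 0)"

text \<open>The differential of \<open>\<xi>\<close> at \<open>proj v\<close>, on the tangent vector represented by \<open>A\<close>.\<close>

definition dsec ::
    "('m::finite rp \<Rightarrow> real ^ 'm) \<Rightarrow> real ^ 'm \<Rightarrow> real ^ 'm \<Rightarrow> real ^ 'm"
  where "dsec \<xi> v A = frechet_derivative (\<xi> \<circ> proj) (at v) A"

text \<open>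
  The decomposition \<open>\<nabla>\<^sub>X Y = \<nabla>\<^sup>\<xi>\<^sub>X Y + h(X, Y) \<xi>\<close>, where \<open>Y\<close> is identified with the section
  \<open>d\<xi>(Y)\<close> of \<open>E\<close>, \<open>\<nabla>\<close> is the flat derivative, and \<open>Z\<close> represents the value of \<open>\<nabla>\<^sup>\<xi>\<^sub>X Y\<close> at
  \<open>proj v\<close>. It determines \<open>h\<close> on \<open>cone \<Omega>\<close>.
\<close>

definition second_form ::
    "'m::finite rp set \<Rightarrow> ('m rp \<Rightarrow> real ^ 'm) \<Rightarrow> 'm tensor2 \<Rightarrow> bool"
  where "second_form \<Omega> \<xi> h \<longleftrightarrow>
    (\<forall>v\<in>cone \<Omega>. bilinear (h v) \<and> (\<forall>A B. h v A B = h v B A)) \<and>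
    (\<forall>X Y. vector_field \<Omega> X \<and> vector_field \<Omega> Y \<longrightarrow>
      (\<forall>v\<in>cone \<Omega>. \<exists>Z.
        frechet_derivative (\<lambda>w. dsec \<xi> w (Y w)) (at v) (X v)
          = dsec \<xi> v Z + h v (X v) (Y v) *\<^sub>R \<xi> (proj v)))"

definition strictly_convex :: "'m::finite rp set \<Rightarrow> 'm tensor2 \<Rightarrow> bool"
  where "strictly_convex \<Omega> h \<longleftrightarrow> (\<forall>v\<in>cone \<Omega>. \<forall>A. A \<notin> span {v} \<longrightarrow> h v A A > 0)"

text \<open>
  The extension of \<open>h\<close> to an inner product \<open>g\<close> on the fibre \<open>real ^ 'm\<close> of \<open>E\<close> at \<open>proj v\<close>.
\<close>

definition extends_metric ::
    "('m::finite rp \<Rightarrow> real ^ 'm) \<Rightarrow> 'm tensor2 \<Rightarrow> real ^ 'm \<Rightarrow>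
     (real ^ 'm \<Rightarrow> real ^ 'm \<Rightarrow> real) \<Rightarrow> bool"
  where "extends_metric \<xi> h v g \<longleftrightarrow> bilinear g \<and> (\<forall>a b. g a b = g b a) \<and>
    (\<forall>A B. g (dsec \<xi> v A) (dsec \<xi> v B) = h v A B) \<and>
    (\<forall>A. g (dsec \<xi> v A) (\<xi> (proj v)) = 0) \<and>
    g (\<xi> (proj v)) (\<xi> (proj v)) = 1"

text \<open>
  The constant volume forms on \<open>real ^ 'm\<close> are the nonzero multiples of the determinant; the
  volume form with factor \<open>k\<close> also provides the orientation.
\<close>

definition vol :: "real \<Rightarrow> ('m::finite \<Rightarrow> real ^ 'm) \<Rightarrow> real"
  where "vol k e = k * det (\<chi> i. e i)"

definition hyperbolic_affine_sphere ::
    "real \<Rightarrow> 'm::finite rp set \<Rightarrow> ('m rp \<Rightarrow> real ^ 'm) \<Rightarrow> 'm tensor2 \<Rightarrow> bool"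
  where "hyperbolic_affine_sphere k \<Omega> \<xi> h \<longleftrightarrow>
    nonvanishing_section \<Omega> \<xi> \<and> second_form \<Omega> \<xi> h \<and>
    proper_map (top_of_set \<Omega>) euclidean \<xi> \<and>
    strictly_convex \<Omega> h \<and>
    (\<forall>v\<in>cone \<Omega>. \<exists>g. extends_metric \<xi> h v g \<and>
      (\<forall>e. (\<forall>i j. g (e i) (e j) = (if i = j then 1 else 0)) \<and> vol k e > 0 \<longrightarrow> vol k e = 1))"

text \<open>
  By the theorem of Cheng and Yau, every proper convex open \<open>\<Omega>\<close> has exactly one such \<open>h\<close> (up to
  the irrelevant values outside \<open>cone \<Omega>\<close>), whatever the volume form.
\<close>

definition blaschke_metric :: "'m::finite rp set \<Rightarrow> 'm tensor2 \<Rightarrow> bool"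
  where "blaschke_metric \<Omega> h \<longleftrightarrow> (\<exists>k \<xi>. k \<noteq> 0 \<and> hyperbolic_affine_sphere k \<Omega> \<xi> h)"

end

theory Submission
  imports Defs
begin

text \<open>
  On the chord of \<open>\<Omega>\<close> through two points \<open>x, y\<close> at Hilbert distance \<open>T\<close>, choose vectors \<open>p, q\<close> over the
  endpoints such that \<open>e\<^sub>t = e\<^sup>t p + e\<^sup>-\<^sup>t q\<close> represents \<open>x\<close> and \<open>y\<close> at times \<open>0\<close> and \<open>T\<close>. If \<open>\<gamma>\<^sub>t\<close> is the
  point of the affine sphere over \<open>e\<^sub>t\<close> and \<open>e\<^sub>t = \<psi>(t) \<gamma>\<^sub>t\<close>, then the Blaschke metric satisfies
  \<open>h(e', e') = 1 - \<psi>''/\<psi>\<close>. Positivity of \<open>h\<close> on the whole chord (\<open>t\<close> ranges over all reals) forces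
  \<open>\<bar>\<psi>'/\<psi>\<bar> < 1\<close>. Finally \<open>sqrt (1 - \<psi>''/\<psi>) \<le> 1 - \<psi>''/(2\<psi>) \<le> 1 - (\<psi>'/\<psi>)'/2\<close>, so the length of the chord
  between \<open>x\<close> and \<open>y\<close> is at most \<open>T + (\<psi>'/\<psi>)(0)/2 - (\<psi>'/\<psi>)(T)/2 < T + 1\<close>.
\<close>

section \<open>Projective lines and the quotient topology\<close>

lemma rp_cases:
  obtains v where "v \<noteq> 0" "x = proj v"
proof -
  have L: "subspace (line_of x)" "dim (line_of x) = 1" using line_of[of x] by auto
  then have "\<not> line_of x \<subseteq> {0}" by (metis dim_eq_0 zero_neq_one)
  then obtain v where v: "v \<in> line_of x" "v \<noteq> 0" by blast
  have "span {v} = line_of x"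
    by (rule subspace_dim_equal) (use L v in \<open>auto simp: span_minimal dim_span dim_singleton\<close>)
  then have "x = proj v" by (metis line_of_proj line_of_inject v(2))
  with v show ?thesis using that by blast
qed

lemma proj_scaleR: "k \<noteq> 0 \<Longrightarrow> proj (k *\<^sub>R v) = proj v"
proof -
  assume k: "k \<noteq> 0"
  have "span {k *\<^sub>R v} = span {v}"
  proof (rule antisym)
    show "span {k *\<^sub>R v} \<subseteq> span {v}" by (rule span_minimal) (auto simp: span_base span_scale)
    have "v = (1/k) *\<^sub>R (k *\<^sub>R v)" using k by simp
    then have "v \<in> span {k *\<^sub>R v}" by (metis span_base span_scale insertI1)
    then show "span {v} \<subseteq> span {k *\<^sub>R v}" by (intro span_minimal) auto
  qed
  then show ?thesis by (simp add: proj_def)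
qed

lemma proj_minus: "proj (- v) = proj v"
  using proj_scaleR[of "-1" v] by simp

lemma proj_eqD:
  assumes "proj v = proj w" "v \<noteq> 0" "w \<noteq> 0"
  obtains k where "k \<noteq> 0" "v = k *\<^sub>R w"
proof -
  have "v \<in> span {w}" using assms by (metis line_of_proj span_base insertI1)
  then obtain k where "v = k *\<^sub>R w" by (auto simp: span_singleton)
  with assms that show ?thesis by force
qed

lemma cone_scaleR: "v \<in> cone U \<Longrightarrow> k \<noteq> 0 \<Longrightarrow> k *\<^sub>R v \<in> cone U"
  by (simp add: cone_def proj_scaleR)

lemma cone_minus_iff: "- v \<in> cone U \<longleftrightarrow> v \<in> cone U"
  by (simp add: cone_def proj_minus)

text \<open>Coordinate functionals of the plane spanned by \<open>v\<close> and \<open>w\<close>,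
  extended to the whole space. Coefficients with respect to \<open>v\<close> and \<open>w\<close>
  are read off below by applying them to vector identities.\<close>

lemma dual_pair:
  assumes "proj v \<noteq> proj w" "v \<noteq> 0" "w \<noteq> 0"
  obtains f g :: "real ^ 'm::finite \<Rightarrow> real"
  where "linear f" "linear g" "f v = 1" "f w = 0" "g v = 0" "g w = 1"
proof -
  have ne: "v \<noteq> w" using assms by auto
  have "v \<notin> span {w}"
  proof
    assume "v \<in> span {w}"
    then obtain k where "v = k *\<^sub>R w" by (auto simp: span_singleton)
    with assms proj_scaleR[of k w] show False by force
  qed
  then have ind: "independent {v, w}"
    using assms ne by (simp add: independent_insert)
  obtain f :: "real ^ 'm \<Rightarrow> real" where "linear f" "\<forall>x\<in>{v,w}. f x = (if x = v then 1 else 0)"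
    using linear_independent_extend[OF ind, of "\<lambda>x. if x = v then 1 else 0"] by blast
  moreover obtain g :: "real ^ 'm \<Rightarrow> real" where "linear g" "\<forall>x\<in>{v,w}. g x = (if x = v then 0 else 1)"
    using linear_independent_extend[OF ind, of "\<lambda>x. if x = v then 0 else 1"] by blast
  ultimately show ?thesis using that ne by auto
qed

lemma in_span_pair:
  fixes v w z :: "'a::real_vector"
  shows "z \<in> span {v, w} \<longleftrightarrow> (\<exists>\<alpha> \<beta>. z = \<alpha> *\<^sub>R v + \<beta> *\<^sub>R w)"
proof -
  have "z \<in> span {v, w} \<longleftrightarrow> (\<exists>\<alpha> \<beta>. z - \<alpha> *\<^sub>R v = \<beta> *\<^sub>R w)"
    by (auto simp: span_breakdown_eq[of z v] span_singleton)
  also have "\<dots> \<longleftrightarrow> (\<exists>\<alpha> \<beta>. z = \<alpha> *\<^sub>R v + \<beta> *\<^sub>R w)"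
    by (simp add: diff_eq_eq add.commute)
  finally show ?thesis .
qed

lemma dim_span_pair:
  assumes "proj v \<noteq> proj w" "v \<noteq> 0" "w \<noteq> (0::real^'m::finite)"
  shows "dim (span {v, w}) = 2"
proof -
  obtain f g :: "real ^ 'm \<Rightarrow> real"
    where fg: "linear f" "linear g" "f v = 1" "f w = 0" "g v = 0" "g w = 1"
    using dual_pair[OF assms] .
  have "v \<notin> span {w}"
    using fg by (auto simp: span_singleton linear_scale)
  then have "independent {v, w}" using assms by (auto simp add: independent_insert)
  moreover have "card {v, w} = 2" using assms(1) by (cases "v = w") auto
  ultimately show ?thesis by (simp add: dim_span dim_eq_card_independent)
qed

definition line_through :: "real ^ 'm::finite \<Rightarrow> real ^ 'm \<Rightarrow> 'm rp set"
  where "line_through v w = {x. line_of x \<subseteq> span {v, w}}"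

lemma proj_line_through:
  assumes "proj v \<noteq> proj w" "v \<noteq> 0" "w \<noteq> 0"
  shows "proj_line (line_through v w)"
  unfolding proj_line_def line_through_def using dim_span_pair[OF assms] subspace_span by blast

lemma proj_in_line_through:
  assumes "z \<noteq> 0"
  shows "proj z \<in> line_through v w \<longleftrightarrow> (\<exists>\<alpha> \<beta>. z = \<alpha> *\<^sub>R v + \<beta> *\<^sub>R w)"
proof -
  have "line_of (proj z) \<subseteq> span {v, w} \<longleftrightarrow> z \<in> span {v, w}"
    unfolding line_of_proj[OF assms]
    using span_minimal[of "{z}" "span {v, w}"] span_base[of z "{z}"] by auto
  then show ?thesis by (simp add: line_through_def in_span_pair)
qed

lemma proj_line_through_basis:
  assumes "v \<noteq> 0" "w \<noteq> 0"
  shows "proj v \<in> line_through v w" "proj w \<in> line_through v w"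
  using assms by (simp_all add: line_through_def line_of_proj span_mono)

lemma proj_line_unique:
  assumes "proj v \<noteq> proj w" "v \<noteq> 0" "w \<noteq> 0" "proj_line l" "proj v \<in> l" "proj w \<in> l"
  shows "l = line_through v w"
proof -
  obtain P where P: "subspace P" "dim P = 2" "l = {x. line_of x \<subseteq> P}"
    using assms by (auto simp: proj_line_def)
  have "v \<in> P" "w \<in> P" using P assms by (auto simp: line_of_proj span_base)
  then have "span {v, w} = P"
    by (intro subspace_dim_equal) (use P dim_span_pair[OF assms(1-3)] in \<open>auto simp: span_minimal\<close>)
  then show ?thesis using P by (simp add: line_through_def)
qed

section \<open>Open sets and closures in projective space, seen through their cones\<close>

lemma open_cone: "open U \<Longrightarrow> open (cone U)"
  by (simp add: open_rp_def)

text \<open>Source of open subsets of projective space: an open set of vectors that is invariant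
  under nonzero scaling is, up to the origin, the full preimage of its image.\<close>

lemma open_rp_image:
  assumes "open W" "\<And>v k. v \<in> W \<Longrightarrow> v \<noteq> 0 \<Longrightarrow> k \<noteq> 0 \<Longrightarrow> k *\<^sub>R v \<in> W"
  shows "open (proj ` (W - {0}))" "cone (proj ` (W - {0})) = W - {0}"
proof -
  show *: "cone (proj ` (W - {0})) = W - {0}"
  proof
    show "cone (proj ` (W - {0})) \<subseteq> W - {0}"
      using assms(2) by (auto simp: cone_def) (metis proj_eqD)
  qed (auto simp: cone_def)
  show "open (proj ` (W - {0}))"
    unfolding open_rp_def * using assms(1) by (simp add: open_delete)
qed

text \<open>From right to left, cones over neighbourhoods are neighbourhoods. Conversely, the
  complement of \<open>closure (cone U)\<close> is invariant under scaling, so it descends to an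
  open set disjoint from \<open>U\<close>.\<close>

lemma proj_in_closure:
  assumes "v \<noteq> 0"
  shows "proj v \<in> closure U \<longleftrightarrow> v \<in> closure (cone U)"
proof
  assume "v \<in> closure (cone U)"
  show "proj v \<in> closure U"
    unfolding closure_iff_nhds_not_empty
  proof (intro allI impI)
    fix A V assume V: "V \<subseteq> A" "open V" "proj v \<in> V"
    then have "cone U \<inter> cone V \<noteq> {}"
      using \<open>v \<in> closure (cone U)\<close> open_cone[OF V(2)] assms
      by (auto simp: closure_iff_nhds_not_empty cone_def)
    then show "U \<inter> A \<noteq> {}" using V by (auto simp: cone_def)
  qed
next
  assume v: "proj v \<in> closure U"
  show "v \<in> closure (cone U)"
  proof (rule ccontr)
    assume nv: "v \<notin> closure (cone U)"
    let ?W = "- closure (cone U)"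
    have W: "k *\<^sub>R z \<in> ?W" if "z \<in> ?W" "k \<noteq> 0" for z k
    proof
      assume "k *\<^sub>R z \<in> closure (cone U)"
      then have "(1/k) *\<^sub>R (k *\<^sub>R z) \<in> (\<lambda>x. (1/k) *\<^sub>R x) ` closure (cone U)" by blast
      also have "\<dots> = closure ((\<lambda>x. (1/k) *\<^sub>R x) ` cone U)" by (simp add: closure_scaleR)
      also have "\<dots> \<subseteq> closure (cone U)"
        by (intro closure_mono) (use that cone_scaleR[of _ U "1/k"] in auto)
      finally show False using that by simp
    qed
    have op: "open (proj ` (?W - {0}))" "cone (proj ` (?W - {0})) = ?W - {0}"
      using open_rp_image[of ?W] W by auto
    have "proj v \<in> proj ` (?W - {0})" using nv assms by auto
    then have "U \<inter> proj ` (?W - {0}) \<noteq> {}"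
      using v op(1) unfolding closure_iff_nhds_not_empty by blast
    then obtain z where "z \<noteq> 0" "z \<notin> closure (cone U)" "proj z \<in> U" by auto
    then show False using closure_subset[of "cone U"] by (auto simp: cone_def)
  qed
qed


section \<open>Convex domains as convex cones\<close>

locale proper_convex_domain =
  fixes \<Omega> :: "'m::finite rp set"
  assumes open_domain: "open \<Omega>" and convex_domain: "convex_rp \<Omega>" and proper_domain: "proper_rp \<Omega>"
begin

lemma zero_notin_cone: "0 \<notin> cone \<Omega>"
  by (simp add: cone_def)

lemma not_line_in_closure:
  assumes "proj v \<noteq> proj w" "v \<noteq> 0" "w \<noteq> 0"
  shows "\<not> line_through v w \<subseteq> closure \<Omega>"
  using proper_domain proj_line_through[OF assms] by (auto simp: proper_rp_def)

text \<open>Up to scaling and sign, the two segments contain every nonzero vector of the plane of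
  \<open>v\<close> and \<open>w\<close>, so a whole projective line would lie in \<Omega>, against
  properness. If \<open>v\<close> and \<open>w\<close> are parallel, one of the segments passes
  through the origin instead.\<close>

lemma not_both_segments:
  assumes "closed_segment v w \<subseteq> cone \<Omega>" "closed_segment v (- w) \<subseteq> cone \<Omega>"
  shows False
proof (cases "proj v = proj w")
  case False
  have vw: "v \<noteq> 0" "w \<noteq> 0" using assms zero_notin_cone by auto
  \<comment> \<open>Dividing by \<open>\<alpha> + \<bar>\<beta>\<bar>\<close> moves the vector onto
    one of the two segments, chosen by the sign of \<beta>.\<close>
  have *: "\<alpha> *\<^sub>R v + \<beta> *\<^sub>R w \<in> cone \<Omega>" if "\<alpha> \<ge> 0" "\<alpha> \<noteq> 0 \<or> \<beta> \<noteq> 0" for \<alpha> \<beta>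
  proof -
    define s where "s = \<alpha> + \<bar>\<beta>\<bar>"
    have s: "s > 0" using that by (auto simp: s_def)
    define u where "u = \<bar>\<beta>\<bar> / s"
    have u: "0 \<le> u" "u \<le> 1" "1 - u = \<alpha> / s"
      using s that by (auto simp: u_def s_def field_simps)
    have "(1 - u) *\<^sub>R v + u *\<^sub>R w \<in> cone \<Omega>" "(1 - u) *\<^sub>R v + u *\<^sub>R (- w) \<in> cone \<Omega>"
      using assms u by (auto simp: closed_segment_def)
    then have "(1 - u) *\<^sub>R v + (\<beta> / s) *\<^sub>R w \<in> cone \<Omega>"
      by (cases "\<beta> \<ge> 0") (auto simp: u_def)
    then have "s *\<^sub>R ((1 - u) *\<^sub>R v + (\<beta> / s) *\<^sub>R w) \<in> cone \<Omega>"
      using s by (intro cone_scaleR) auto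
    then show ?thesis using s u(3) by (simp add: scaleR_add_right)
  qed
  have "line_through v w \<subseteq> \<Omega>"
  proof
    fix x assume x: "x \<in> line_through v w"
    obtain z where z: "z \<noteq> 0" "x = proj z" by (rule rp_cases)
    then obtain \<alpha> \<beta> where ab: "z = \<alpha> *\<^sub>R v + \<beta> *\<^sub>R w"
      using x by (auto simp: proj_in_line_through)
    have "z \<in> cone \<Omega>"
    proof (cases "\<alpha> \<ge> 0")
      case True
      then show ?thesis using *[of \<alpha> \<beta>] ab z by (cases "\<alpha> = 0") auto
    next
      case False
      then have "- z \<in> cone \<Omega>" using *[of "-\<alpha>" "-\<beta>"] ab by auto
      then show ?thesis by (simp add: cone_minus_iff)
    qed
    then show "x \<in> \<Omega>" using z by (simp add: cone_def)
  qed
  then show False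
    using not_line_in_closure[OF False vw] closure_subset by blast
next
  case True
  have vw: "v \<noteq> 0" "w \<noteq> 0" using assms zero_notin_cone by auto
  then obtain k where k: "k \<noteq> 0" "v = k *\<^sub>R w" using proj_eqD[OF True] by auto
  have "0 \<in> closed_segment v w \<or> 0 \<in> closed_segment v (- w)"
  proof (cases "k > 0")
    case True
    have "0 = (1 - k / (1 + k)) *\<^sub>R v + (k / (1 + k)) *\<^sub>R (- w)"
      using True by (simp add: k field_simps flip: scaleR_diff_left)
    then show ?thesis using True unfolding closed_segment_def
      by (intro disjI2 CollectI exI[of _ "k / (1 + k)"]) auto
  next
    case False
    have "0 = (1 - k / (k - 1)) *\<^sub>R v + (k / (k - 1)) *\<^sub>R w"
      using False k(1) by (simp add: k field_simps flip: scaleR_add_left)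
    then show ?thesis using False k(1) unfolding closed_segment_def
      by (intro disjI1 CollectI exI[of _ "k / (k - 1)"]) (auto simp: field_simps)
  qed
  then show False using assms zero_notin_cone by auto
qed

text \<open>If both segments left the cone, the two missing points would disconnect \<open>\<Omega> \<inter> l\<close>: they are
  the zeros on \<open>l\<close> of a quadratic form \<open>Q\<close> that has opposite signs at \<open>v\<close> and \<open>w\<close>.\<close>

lemma some_segment:
  assumes "v \<in> cone \<Omega>" "w \<in> cone \<Omega>"
  shows "closed_segment v w \<subseteq> cone \<Omega> \<or> closed_segment v (- w) \<subseteq> cone \<Omega>"
proof (cases "proj v = proj w")
  case True
  have vw: "v \<noteq> 0" "w \<noteq> 0" using assms zero_notin_cone by auto
  then obtain k where k: "k \<noteq> 0" "w = k *\<^sub>R v" using proj_eqD[OF True[symmetric]] by auto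
  \<comment> \<open>The one of \<open>w\<close> and \<open>- w\<close> on the same open ray as
    \<open>v\<close>; the segment joining them stays on that ray and avoids the origin.\<close>
  define w' where "w' = \<bar>k\<bar> *\<^sub>R v"
  have "closed_segment v w' \<subseteq> cone \<Omega>"
  proof
    fix z assume "z \<in> closed_segment v w'"
    then obtain u where u: "0 \<le> u" "u \<le> 1" "z = (1 - u) *\<^sub>R v + u *\<^sub>R (\<bar>k\<bar> *\<^sub>R v)"
      by (auto simp: closed_segment_def w'_def)
    have "z = (1 - u + u * \<bar>k\<bar>) *\<^sub>R v" by (simp add: u algebra_simps)
    moreover have "1 - u + u * \<bar>k\<bar> \<noteq> 0"
    proof (cases "u = 1")
      case False
      then have "1 - u > 0" "u * \<bar>k\<bar> \<ge> 0" using u by auto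
      then show ?thesis by linarith
    qed (use k in auto)
    ultimately show "z \<in> cone \<Omega>" using cone_scaleR[OF assms(1)] by simp
  qed
  moreover have "w' = w \<or> w' = - w" using k by (auto simp: w'_def abs_if)
  ultimately show ?thesis by auto
next
  case False
  have vw: "v \<noteq> 0" "w \<noteq> 0" using assms zero_notin_cone by auto
  obtain f g :: "real ^ 'm \<Rightarrow> real"
    where fg: "linear f" "linear g" "f v = 1" "f w = 0" "g v = 0" "g w = 1"
    using dual_pair[OF False vw] .
  note lin = linear_add[OF fg(1)] linear_add[OF fg(2)] linear_scale[OF fg(1)] linear_scale[OF fg(2)]
  show ?thesis
  proof (rule ccontr)
    assume "\<not> ?thesis"
    then obtain r s where q1: "(1 - r) *\<^sub>R v + r *\<^sub>R w \<notin> cone \<Omega>" and q2: "(1 - s) *\<^sub>R v + s *\<^sub>R (- w) \<notin> cone \<Omega>"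
      and rs: "0 \<le> r" "r \<le> 1" "0 \<le> s" "s \<le> 1"
      by (auto simp: closed_segment_def)
    have ne: "r \<noteq> 0" "r \<noteq> 1" "s \<noteq> 0" "s \<noteq> 1"
      using q1 q2 assms cone_minus_iff[of w \<Omega>] by auto
    define Q where "Q z = ((1 - r) * g z - r * f z) * ((1 - s) * g z + s * f z)" for z
    define A where "A = proj ` ({z. Q z > 0} - {0})"
    define B where "B = proj ` ({z. Q z < 0} - {0})"
    have Qs: "Q (k *\<^sub>R z) = k^2 * Q z" for k z
      by (simp add: Q_def lin power2_eq_square algebra_simps)
    have cont: "continuous_on UNIV Q"
      unfolding Q_def using fg(1,2)
      by (intro continuous_intros linear_continuous_on linear_conv_bounded_linear[THEN iffD1])
    have op: "open {z. Q z > 0}" "open {z. Q z < 0}"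
      using cont by (auto intro!: open_Collect_less continuous_intros)
    have A: "open A" "cone A = {z. Q z > 0} - {0}"
      unfolding A_def using open_rp_image[OF op(1)] by (auto simp: Qs)
    have B: "open B" "cone B = {z. Q z < 0} - {0}"
      unfolding B_def using open_rp_image[OF op(2)] by (auto simp: Qs mult_less_0_iff)
    have rp: "proj z \<in> U \<longleftrightarrow> z \<in> cone U" if "z \<noteq> 0" for z and U :: "'m rp set"
      using that by (simp add: cone_def)
    have "connected (\<Omega> \<inter> line_through v w)"
      using convex_domain proj_line_through[OF False vw] by (auto simp: convex_rp_def)
    moreover have "\<Omega> \<inter> line_through v w \<subseteq> A \<union> B"
    proof
      fix x assume x: "x \<in> \<Omega> \<inter> line_through v w"
      obtain z where z: "z \<noteq> 0" "x = proj z" by (rule rp_cases)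
      then obtain \<alpha> \<beta> where ab: "z = \<alpha> *\<^sub>R v + \<beta> *\<^sub>R w"
        using x by (auto simp: proj_in_line_through)
      have zc: "z \<in> cone \<Omega>" using x z by (auto simp: cone_def)
      have fgz: "f z = \<alpha>" "g z = \<beta>" by (auto simp: ab lin fg)
      \<comment> \<open>A vanishing factor of \<open>Q\<close> makes \<open>z\<close> a nonzero
        multiple of the missing point of one of the segments, which would put that point into the
        cone.\<close>
      have "Q z \<noteq> 0"
      proof
        assume "Q z = 0"
        then consider "(1 - r) * \<beta> = r * \<alpha>" | "(1 - s) * \<beta> = - s * \<alpha>"
          by (auto simp: Q_def fgz)
        then show False
        proof cases
          case 1
          then have b: "\<beta> = \<alpha> / (1 - r) * r" using ne by (simp add: field_simps)
          then have "z = (\<alpha> / (1 - r)) *\<^sub>R ((1 - r) *\<^sub>R v + r *\<^sub>R w)"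
            using ne by (simp add: ab scaleR_add_right)
          moreover have "\<alpha> \<noteq> 0" using b ab z by auto
          ultimately show False using q1 zc ne cone_scaleR[of z \<Omega> "(1 - r) / \<alpha>"] by simp
        next
          case 2
          then have b: "\<beta> = - (\<alpha> / (1 - s) * s)" using ne by (simp add: field_simps)
          then have "z = (\<alpha> / (1 - s)) *\<^sub>R ((1 - s) *\<^sub>R v + s *\<^sub>R (- w))"
            using ne by (simp add: ab scaleR_diff_right)
          moreover have "\<alpha> \<noteq> 0" using b ab z by auto
          ultimately show False using q2 zc ne cone_scaleR[of z \<Omega> "(1 - s) / \<alpha>"] by simp
        qed
      qed
      then show "x \<in> A \<union> B" using z A(2) B(2) rp[of z] by auto
    qed
    moreover have "A \<inter> B = {}"
    proof (rule ccontr)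
      assume "A \<inter> B \<noteq> {}"
      then obtain x where "x \<in> A" "x \<in> B" by auto
      moreover obtain z where "z \<noteq> 0" "x = proj z" by (rule rp_cases)
      ultimately show False using A(2) B(2) rp[of z] by auto
    qed
    moreover have "proj v \<in> \<Omega> \<inter> line_through v w \<inter> B" "proj w \<in> \<Omega> \<inter> line_through v w \<inter> A"
    proof -
      have "Q v < 0" "Q w > 0" using ne rs by (auto simp: Q_def fg mult_less_0_iff)
      moreover have "proj v \<in> line_through v w" "proj w \<in> line_through v w"
        using proj_line_through_basis[OF vw] by auto
      ultimately show "proj v \<in> \<Omega> \<inter> line_through v w \<inter> B" "proj w \<in> \<Omega> \<inter> line_through v w \<inter> A"
        using assms vw A(2) B(2) rp[of v] rp[of w] by auto
    qed
    ultimately show False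
      unfolding connected_def using A(1) B(1) by blast
  qed
qed

text \<open>\<open>C\<close> consists of the vectors visible from \<open>v0\<close> inside the cone.
  By the two preceding lemmas exactly one of \<open>w\<close> and \<open>- w\<close> is visible for
  each \<open>w\<close> in the cone, so \<open>C\<close> and its negative separate the cone;
  convexity and homogeneity then follow from connectedness of segments.\<close>

lemma half_cone:
  assumes "v0 \<in> cone \<Omega>"
  obtains C where "open C" "convex C" "v0 \<in> C" "\<And>v. v \<in> cone \<Omega> \<longleftrightarrow> v \<in> C \<or> - v \<in> C" "0 \<notin> C"
    "\<And>v t. v \<in> C \<Longrightarrow> t > 0 \<Longrightarrow> t *\<^sub>R v \<in> C"
proof -
  define C where "C = {w. closed_segment v0 w \<subseteq> cone \<Omega>}"
  have sub: "w \<in> cone \<Omega>" if "w \<in> C" for w using that by (auto simp: C_def)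
  have iff: "v \<in> cone \<Omega> \<longleftrightarrow> v \<in> C \<or> - v \<in> C" for v
    using some_segment[OF assms, of v] sub[of v] sub[of "-v"] by (auto simp: C_def cone_minus_iff)
  have disj: "\<not> (v \<in> C \<and> - v \<in> C)" for v
    using not_both_segments[of v0 v] by (auto simp: C_def)
  have "open C"
    unfolding open_contains_ball
  proof
    fix w assume "w \<in> C"
    \<comment> \<open>The compact segment has a uniform tube inside the open cone; moving its
      endpoint by less than \<open>e\<close> keeps the whole segment in the tube.\<close>
    then obtain e where e: "e > 0" "(\<Union>x\<in>closed_segment v0 w. ball x e) \<subseteq> cone \<Omega>"
      using compact_subset_open_imp_ball_epsilon_subset[of "closed_segment v0 w" "cone \<Omega>"]
        open_cone[OF open_domain] by (auto simp: C_def)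
    have "ball w e \<subseteq> C"
    proof
      fix w' assume w': "w' \<in> ball w e"
      show "w' \<in> C" unfolding C_def
      proof safe
        fix z assume "z \<in> closed_segment v0 w'"
        then obtain u where u: "0 \<le> u" "u \<le> 1" "z = (1 - u) *\<^sub>R v0 + u *\<^sub>R w'"
          by (auto simp: closed_segment_def)
        define y where "y = (1 - u) *\<^sub>R v0 + u *\<^sub>R w"
        have "y - z = u *\<^sub>R (w - w')" by (simp add: y_def u algebra_simps)
        then have "dist y z = u * dist w w'" using u by (simp add: dist_norm)
        also have "\<dots> \<le> 1 * dist w w'" using u by (intro mult_right_mono) auto
        also have "\<dots> < e" using w' by simp
        finally have "z \<in> ball y e" by simp
        moreover have "y \<in> closed_segment v0 w" using u by (auto simp: y_def closed_segment_def)
        ultimately show "z \<in> cone \<Omega>" using e by blast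
      qed
    qed
    then show "\<exists>e>0. ball w e \<subseteq> C" using e by blast
  qed
  \<comment> \<open>\<open>C\<close> and its negative are disjoint open sets covering the cone, so a
    connected part of the cone cannot pass from one to the other.\<close>
  have conn: "S \<subseteq> C" if S: "connected S" "S \<subseteq> cone \<Omega>" "w \<in> S" "w \<in> C" for S w
  proof -
    have op: "open (uminus ` C)" using \<open>open C\<close> by (rule open_negations)
    have "z \<in> C" if z: "z \<in> S" for z
    proof (rule ccontr)
      assume "z \<notin> C"
      have "C \<inter> uminus ` C \<inter> S = {}" using disj by force
      moreover have "S \<subseteq> C \<union> uminus ` C" using S(2) iff by force
      moreover have "z \<in> uminus ` C \<inter> S" using z S(2) iff[of z] \<open>z \<notin> C\<close> by force
      ultimately show False
        using S \<open>open C\<close> op unfolding connected_def by blast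
    qed
    then show ?thesis by blast
  qed
  have "convex C"
    unfolding convex_contains_segment
  proof safe
    fix w1 w2 z assume w: "w1 \<in> C" "w2 \<in> C" and z: "z \<in> closed_segment w1 w2"
    \<comment> \<open>Such a segment, starting in \<open>C\<close>, would carry \<open>- w2\<close>
      into \<open>C\<close>. Hence the segment from \<open>w1\<close> to \<open>w2\<close> is the
      one that stays in the cone.\<close>
    have "\<not> closed_segment w1 (- w2) \<subseteq> cone \<Omega>"
      using conn[of "closed_segment w1 (- w2)" w1] w disj[of w2] by auto
    then have "closed_segment w1 w2 \<subseteq> cone \<Omega>" using some_segment[of w1 w2] w sub by blast
    then show "z \<in> C" using conn[of "closed_segment w1 w2" w1] w z by auto
  qed
  moreover have "t *\<^sub>R v \<in> C" if "v \<in> C" "t > 0" for v t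
  proof -
    have "closed_segment v (t *\<^sub>R v) \<subseteq> cone \<Omega>"
    proof
      fix z assume "z \<in> closed_segment v (t *\<^sub>R v)"
      then obtain u where u: "0 \<le> u" "u \<le> 1" "z = (1 - u) *\<^sub>R v + u *\<^sub>R (t *\<^sub>R v)"
        by (auto simp: closed_segment_def)
      have "z = (1 - u + u * t) *\<^sub>R v" by (simp add: u algebra_simps)
      moreover have "1 - u + u * t > 0"
      proof (cases "u = 1")
        case False
        then have "1 - u > 0" "u * t \<ge> 0" using u that by auto
        then show ?thesis by linarith
      qed (use that in auto)
      ultimately show "z \<in> cone \<Omega>" using cone_scaleR[OF sub[OF that(1)]] by simp
    qed
    then show ?thesis using conn[of "closed_segment v (t *\<^sub>R v)" v] that by auto
  qed
  moreover have "v0 \<in> C" using assms by (simp add: C_def)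
  moreover have "0 \<notin> C" using sub zero_notin_cone by blast
  ultimately show ?thesis using that \<open>open C\<close> iff by metis
qed

end

section \<open>The open convex half \<open>C\<close> of the cone and its boundary points\<close>

locale half_of_cone = proper_convex_domain +
  fixes C
  assumes open_C: "open C" and convex_C: "convex C" and zero_notin_C: "0 \<notin> C"
    and cone_iff: "v \<in> cone \<Omega> \<longleftrightarrow> v \<in> C \<or> - v \<in> C"
    and scale_C: "v \<in> C \<Longrightarrow> t > 0 \<Longrightarrow> t *\<^sub>R v \<in> C"
begin

lemma scale_closure_C:
  assumes "v \<in> closure C" "t > 0"
  shows "t *\<^sub>R v \<in> closure C"
proof -
  have "t *\<^sub>R v \<in> closure ((*\<^sub>R) t ` C)" using assms by (simp flip: closure_scaleR)
  also have "\<dots> \<subseteq> closure C" by (intro closure_mono) (use assms scale_C in auto)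
  finally show ?thesis .
qed

text \<open>The midpoint of an interior point and a closure point of a convex set is interior;
  doubling it gives the sum.\<close>

lemma add_closure_C:
  assumes "v \<in> C" "p \<in> closure C"
  shows "v + p \<in> C"
proof -
  have "(1/2) *\<^sub>R (v + p) \<in> C"
  proof (cases "v = p")
    case False
    have "interior C = C" using open_C by (simp add: interior_open)
    then have "open_segment v p \<subseteq> C"
      using in_interior_closure_convex_segment[OF convex_C _ assms(2), of v] assms(1) by simp
    moreover have "midpoint v p \<in> open_segment v p" using False by simp
    ultimately show ?thesis by (auto simp: midpoint_def)
  qed (use assms scale_C[of "2 *\<^sub>R v" "1/2"] in \<open>simp flip: scaleR_2\<close>)
  then show ?thesis using scale_C[of "(1/2) *\<^sub>R (v + p)" 2] by simp
qed

lemma scale_closure_C_nonneg: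
  assumes "v \<in> closure C" "t \<ge> 0"
  shows "t *\<^sub>R v \<in> closure C"
proof (cases "t = 0")
  case True
  have "C \<noteq> {}" using assms by auto
  then obtain u where u: "u \<in> C" by auto
  have "(\<lambda>n. (1 / real (Suc n)) *\<^sub>R u) \<longlonglongrightarrow> 0 *\<^sub>R u"
    by (intro tendsto_intros LIMSEQ_Suc[OF lim_1_over_n])
  moreover have "(1 / real (Suc n)) *\<^sub>R u \<in> C" for n using scale_C[OF u] by simp
  ultimately show ?thesis
    unfolding closure_sequential True
    by (intro exI[of _ "\<lambda>n. (1 / real (Suc n)) *\<^sub>R u"]) (auto simp del: of_nat_Suc)
qed (use assms scale_closure_C in auto)

text \<open>Splitting off \<open>min s t\<close> times \<open>a + b\<close>, which lies in
  \<open>C\<close>, leaves a nonnegative combination of closure points.\<close>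

lemma sector:
  assumes "a \<in> closure C" "b \<in> closure C" "a + b \<in> C" "s > 0" "t > 0"
  shows "s *\<^sub>R a + t *\<^sub>R b \<in> C"
proof -
  define m where "m = min s t"
  have m: "m > 0" "m \<le> s" "m \<le> t" using assms by (auto simp: m_def)
  have "m *\<^sub>R (a + b) \<in> C" using scale_C assms(3) m by blast
  then have "m *\<^sub>R (a + b) + (s - m) *\<^sub>R a + (t - m) *\<^sub>R b \<in> C"
    using m assms(1,2) by (intro add_closure_C scale_closure_C_nonneg) auto
  then show ?thesis by (simp add: algebra_simps)
qed

lemma minus_notin_closure_C: "v \<in> C \<Longrightarrow> - v \<notin> closure C"
  using add_closure_C[of v "-v"] zero_notin_C by auto

text \<open>Otherwise the closure contains the full line through \<open>p\<close>, and adding it to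
  positive multiples of some \<open>z\<close> in \<open>C\<close> gives an open half-plane inside
  \<open>C\<close>. The projective line through \<open>z\<close> and \<open>p\<close> would then lie
  in the closure of \<Omega>.\<close>

lemma closure_C_salient:
  assumes "C \<noteq> {}" "p \<in> closure C" "- p \<in> closure C"
  shows "p = 0"
proof (rule ccontr)
  assume p: "p \<noteq> 0"
  obtain z where z: "z \<in> C" using assms(1) by auto
  have z0: "z \<noteq> 0" using z zero_notin_C by auto
  have ne: "proj z \<noteq> proj p"
  proof
    assume "proj z = proj p"
    then obtain k where "k \<noteq> 0" "z = k *\<^sub>R p" using z0 p by (auto elim: proj_eqD)
    then have "- z \<in> closure C"
      using scale_closure_C[OF assms(2), of "-k"] scale_closure_C[OF assms(3), of k]
      by (cases "k > 0") auto
    then show False using minus_notin_closure_C z by blast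
  qed
  have sp: "t *\<^sub>R p \<in> closure C" for t
  proof (cases "t = 0")
    case True
    have "p \<in> closure C \<Longrightarrow> midpoint p (-p) \<in> closure C"
      using assms convex_closure[OF convex_C] midpoint_in_closed_segment[of p "-p"]
      by (meson convex_contains_segment subsetD)
    then show ?thesis using True assms by (simp add: midpoint_def)
  next
    case False
    then show ?thesis
      using scale_closure_C[OF assms(2), of t] scale_closure_C[OF assms(3), of "-t"]
      by (cases "t > 0") auto
  qed
  have pos: "s *\<^sub>R z + t *\<^sub>R p \<in> C" if "s > 0" for s t
    using add_closure_C[OF scale_C[OF z that] sp] .
  have "line_through z p \<subseteq> closure \<Omega>"
  proof
    fix x assume x: "x \<in> line_through z p"
    obtain u where u: "u \<noteq> 0" "x = proj u" by (rule rp_cases)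
    then obtain s t where st: "u = s *\<^sub>R z + t *\<^sub>R p"
      using x by (auto simp: proj_in_line_through)
    have "u \<in> closure (cone \<Omega>)"
    proof (cases "s = 0")
      case True
      have "closure C \<subseteq> closure (cone \<Omega>)" by (intro closure_mono) (auto simp: cone_iff)
      then show ?thesis using sp[of t] True st by auto
    next
      case False
      then have "u \<in> cone \<Omega>"
        using pos[of s t] pos[of "-s" "-t"] by (cases "s > 0") (auto simp: st cone_iff)
      then show ?thesis using closure_subset by blast
    qed
    then show "x \<in> closure \<Omega>" using u by (simp add: proj_in_closure)
  qed
  then show False using not_line_in_closure[OF ne z0 p] by blast
qed

text \<open>Produces the endpoints of a chord. If the ray never left \<open>C\<close>, the vectors
  \<open>v / n - w\<close> would lie in \<open>C\<close> and converge to \<open>- w\<close>;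
  otherwise the connected ray meets the frontier of \<open>C\<close>.\<close>

lemma ray_exit:
  assumes "v \<in> C" "w \<in> C"
  obtains s where "s > 0" "v - s *\<^sub>R w \<in> closure C" "v - s *\<^sub>R w \<notin> C"
proof -
  define R where "R = (\<lambda>s. v - s *\<^sub>R w) ` {0..}"
  have "connected R"
    unfolding R_def by (intro connected_continuous_image continuous_intros) auto
  moreover have "v \<in> R" by (auto simp: R_def intro!: image_eqI[of _ _ 0])
  moreover have "\<not> R \<subseteq> C"
  proof
    assume "R \<subseteq> C"
    then have ray: "v - s *\<^sub>R w \<in> C" if "s \<ge> 0" for s using that by (auto simp: R_def)
    have "- w \<in> closure C"
      unfolding closure_sequential
    proof (intro exI conjI allI)
      show "(1 / real (Suc n)) *\<^sub>R (v - real (Suc n) *\<^sub>R w) \<in> C" for n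
        using ray[of "real (Suc n)"] by (intro scale_C) auto
      have "(\<lambda>n. (1 / real (Suc n)) *\<^sub>R v - w) \<longlonglongrightarrow> 0 *\<^sub>R v - w"
        by (intro tendsto_intros LIMSEQ_Suc[OF lim_1_over_n])
      then show "(\<lambda>n. (1 / real (Suc n)) *\<^sub>R (v - real (Suc n) *\<^sub>R w)) \<longlonglongrightarrow> - w"
        by (simp add: scaleR_diff_right del: of_nat_Suc)
    qed
    then show False using minus_notin_closure_C assms by blast
  qed
  ultimately obtain z where "z \<in> R" "z \<in> frontier C"
    using connected_Int_frontier[of R C] assms(1) by blast
  then obtain s where s: "s \<ge> 0" "v - s *\<^sub>R w \<in> closure C" "v - s *\<^sub>R w \<notin> C"
    using open_C by (auto simp: R_def frontier_def interior_open)
  moreover have "s \<noteq> 0" using s assms by auto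
  ultimately show ?thesis using that[of s] by auto
qed

text \<open>A combination of \<open>a\<close> and \<open>b\<close> with coefficients of equal sign
  lies in \<open>C\<close> or its negative. With opposite signs, membership in the closure would
  force \<open>a\<close> or \<open>b\<close> into \<open>C\<close>. Only the two endpoints
  remain.\<close>

lemma frontier_on_line:
  assumes "a \<in> closure C" "a \<notin> C" "b \<in> closure C" "b \<notin> C"
    and "a \<noteq> 0" "b \<noteq> 0" "a + b \<in> C"
  shows "line_through a b \<inter> frontier \<Omega> = {proj a, proj b}"
proof -
  have cl: "p \<in> closure (cone \<Omega>) \<longleftrightarrow> p \<in> closure C \<or> - p \<in> closure C" for p
  proof -
    have "cone \<Omega> = C \<union> (*\<^sub>R) (-1) ` C"
      by (auto simp: cone_iff intro: image_eqI[of _ _ "- x" for x])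
    then have "closure (cone \<Omega>) = closure C \<union> (*\<^sub>R) (-1) ` closure C"
      by (simp only: closure_Un closure_scaleR)
    then show ?thesis by (auto intro: image_eqI[of _ _ "- p"])
  qed
  have fr: "proj p \<in> frontier \<Omega> \<longleftrightarrow> (p \<in> closure C \<or> - p \<in> closure C) \<and> p \<notin> cone \<Omega>"
    if "p \<noteq> 0" for p
    using that open_domain by (simp add: frontier_def interior_open proj_in_closure cl) (simp add: cone_def)
  have end_notin: "e \<notin> cone \<Omega>" if "e \<in> closure C" "e \<notin> C" for e
    using that minus_notin_closure_C[of "-e"] by (auto simp: cone_iff)
  have key: "\<alpha> = 0 \<or> \<beta> = 0"
    if z: "z = \<alpha> *\<^sub>R a + \<beta> *\<^sub>R b" "z \<in> closure C" "z \<notin> C" for z \<alpha> \<beta>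
  proof (rule ccontr)
    assume nz: "\<not> ?thesis"
    consider "\<alpha> > 0" "\<beta> > 0" | "\<alpha> < 0" "\<beta> < 0" | "\<alpha> > 0" "\<beta> < 0" | "\<alpha> < 0" "\<beta> > 0"
      using nz by linarith
    then show False
    proof cases
      case 1
      then show False using z sector[OF assms(1,3,7)] by blast
    next
      case 2
      then have "- z \<in> C" using z sector[OF assms(1,3,7), of "-\<alpha>" "-\<beta>"] by simp
      then show False using minus_notin_closure_C[of "- z"] z(2) by simp
    next
      case 3
      \<comment> \<open>Adding the multiple \<open>-\<beta>\<close> of \<open>a + b\<close> cancels
        the \<open>b\<close> component of \<open>z\<close> and leaves a positive multiple of
        \<open>a\<close> in \<open>C\<close>.\<close>
      have "(-\<beta> *\<^sub>R a + -\<beta> *\<^sub>R b) + z \<in> C"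
        by (rule add_closure_C[OF sector[OF assms(1,3,7)] z(2)]) (use 3 in auto)
      then have "(\<alpha> - \<beta>) *\<^sub>R a \<in> C" by (simp add: z algebra_simps)
      then show False using scale_C[of "(\<alpha> - \<beta>) *\<^sub>R a" "1 / (\<alpha> - \<beta>)"] 3 assms(2) by simp
    next
      case 4
      have "(-\<alpha> *\<^sub>R a + -\<alpha> *\<^sub>R b) + z \<in> C"
        by (rule add_closure_C[OF sector[OF assms(1,3,7)] z(2)]) (use 4 in auto)
      then have "(\<beta> - \<alpha>) *\<^sub>R b \<in> C" by (simp add: z algebra_simps)
      then show False using scale_C[of "(\<beta> - \<alpha>) *\<^sub>R b" "1 / (\<beta> - \<alpha>)"] 4 assms(4) by simp
    qed
  qed
  show ?thesis
  proof (intro equalityI subsetI)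
    fix x assume x: "x \<in> line_through a b \<inter> frontier \<Omega>"
    obtain z where z: "z \<noteq> 0" "x = proj z" by (rule rp_cases)
    have "\<exists>z'. z' \<noteq> 0 \<and> x = proj z' \<and> z' \<in> closure C \<and> z' \<notin> C"
    proof (cases "z \<in> closure C")
      case True
      then show ?thesis using z x fr[of z] cone_iff[of z] by auto
    next
      case False
      then show ?thesis using z x fr[of z] cone_iff[of z]
        by (intro exI[of _ "-z"]) (auto simp: proj_minus)
    qed
    then obtain u where u: "u \<noteq> 0" "x = proj u" "u \<in> closure C" "u \<notin> C" by auto
    then obtain \<alpha> \<beta> where ab: "u = \<alpha> *\<^sub>R a + \<beta> *\<^sub>R b"
      using x by (auto simp: proj_in_line_through)
    then consider "\<alpha> = 0" | "\<beta> = 0" using key[OF ab] u by auto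
    then show "x \<in> {proj a, proj b}"
    proof cases
      case 1 then show ?thesis using u ab proj_scaleR[of \<beta> b] by auto
    next
      case 2 then show ?thesis using u ab proj_scaleR[of \<alpha> a] by auto
    qed
  next
    fix x assume "x \<in> {proj a, proj b}"
    then show "x \<in> line_through a b \<inter> frontier \<Omega>"
      using proj_line_through_basis[of a b] fr assms end_notin by auto
  qed
qed

end


section \<open>The Hilbert distance along a chord\<close>

text \<open>Any other admissible basis is \<open>l *\<^sub>R u\<close>,
  \<open>k *\<^sub>R w\<close>. Matching the point with coordinate 1 forces \<open>l = k\<close>, so
  the coordinate of the fourth point is independent of the chart.\<close>

lemma cross_ratio_eq:
  fixes u w :: "real ^ 'm::finite"
  assumes "u \<noteq> 0" "w \<noteq> 0" "proj u \<noteq> proj w"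
  shows "cross_ratio (proj w) (proj (u + w)) (proj u) (proj (t *\<^sub>R u + w)) = t"
  unfolding cross_ratio_def
proof (rule the_equality)
  show "\<exists>u' w'. u' \<noteq> 0 \<and> w' \<noteq> 0 \<and> proj u' \<noteq> proj w' \<and> proj w = proj w' \<and>
      proj (u + w) = proj (u' + w') \<and> proj u = proj u' \<and> proj (t *\<^sub>R u + w) = proj (t *\<^sub>R u' + w')"
    using assms by blast
next
  fix t' assume "\<exists>u' w'. u' \<noteq> 0 \<and> w' \<noteq> 0 \<and> proj u' \<noteq> proj w' \<and> proj w = proj w' \<and>
      proj (u + w) = proj (u' + w') \<and> proj u = proj u' \<and> proj (t *\<^sub>R u + w) = proj (t' *\<^sub>R u' + w')"
  then obtain u' w' where h: "u' \<noteq> 0" "w' \<noteq> 0" "proj w' = proj w" "proj u' = proj u"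
    "proj (u' + w') = proj (u + w)" "proj (t' *\<^sub>R u' + w') = proj (t *\<^sub>R u + w)"
    by metis
  obtain f g :: "real ^ 'm \<Rightarrow> real"
    where fg: "linear f" "linear g" "f u = 1" "f w = 0" "g u = 0" "g w = 1"
    using dual_pair[OF assms(3,1,2)] .
  note lin = linear_add[OF fg(1)] linear_add[OF fg(2)] linear_scale[OF fg(1)] linear_scale[OF fg(2)]
    linear_0[OF fg(1)] linear_0[OF fg(2)]
  obtain k where k: "k \<noteq> 0" "w' = k *\<^sub>R w" using proj_eqD[OF h(3)] h assms by auto
  obtain l where l: "l \<noteq> 0" "u' = l *\<^sub>R u" using proj_eqD[OF h(4)] h assms by auto
  have fw: "g (s *\<^sub>R u + w) = 1" "f (s *\<^sub>R u + w) = s" "g (s *\<^sub>R u' + w') = k" "f (s *\<^sub>R u' + w') = s * l" for s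
    by (auto simp: lin fg k l)
  then have nz: "s *\<^sub>R u + w \<noteq> 0" "s *\<^sub>R u' + w' \<noteq> 0" for s
    using lin k(1) by (metis zero_neq_one)+
  have eq: "s' * l = k * s" if pe: "proj (s' *\<^sub>R u' + w') = proj (s *\<^sub>R u + w)" for s s'
  proof -
    obtain m where m: "s' *\<^sub>R u' + w' = m *\<^sub>R (s *\<^sub>R u + w)" using proj_eqD[OF pe nz(2) nz(1)] .
    have "k = m" "s' * l = m * s" using arg_cong[OF m, of g] arg_cong[OF m, of f] fw by (auto simp: lin)
    then show ?thesis by simp
  qed
  have "l = k" using eq[of 1 1] h by simp
  then show "t' = t" using eq[OF h(6)] k by simp
qed

context proper_convex_domain
begin

text \<open>The endpoints of the chord are found by leaving \<open>C\<close> from each of the two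
  points in the direction opposite to the other. The endpoint on the side of \<open>x\<close> serves
  as \<open>q\<close>, and a multiple of the other one as \<open>p\<close>, scaled so that
  \<open>x\<close> lies over \<open>p + q\<close>.\<close>

lemma hilbert_chord:
  assumes "x \<in> \<Omega>" "y \<in> \<Omega>" "x \<noteq> y"
  obtains p q T where "p \<noteq> 0" "q \<noteq> 0" "proj p \<noteq> proj q" "T > 0"
    "\<And>s t. s > 0 \<Longrightarrow> t > 0 \<Longrightarrow> s *\<^sub>R p + t *\<^sub>R q \<in> cone \<Omega>"
    "x = proj (p + q)" "y = proj (exp (2 * T) *\<^sub>R p + q)" "hilbert_dist \<Omega> x y = T"
proof -
  obtain v where v: "v \<noteq> 0" "x = proj v" by (rule rp_cases)
  then have "v \<in> cone \<Omega>" using assms by (simp add: cone_def)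
  then obtain C where C: "open C" "convex C" "v \<in> C" "\<And>v. v \<in> cone \<Omega> \<longleftrightarrow> v \<in> C \<or> - v \<in> C" "0 \<notin> C"
    "\<And>v t. v \<in> C \<Longrightarrow> t > 0 \<Longrightarrow> t *\<^sub>R v \<in> C"
    by (rule half_cone) blast
  interpret half_of_cone \<Omega> C
    by unfold_locales (use C in auto)
  obtain w where w: "w \<in> C" "y = proj w"
  proof -
    obtain w where w: "w \<noteq> 0" "y = proj w" by (rule rp_cases)
    then have "w \<in> cone \<Omega>" using assms by (simp add: cone_def)
    then show ?thesis using that[of w] that[of "-w"] w by (auto simp: cone_iff proj_minus)
  qed
  have w0: "w \<noteq> 0" using w C by auto
  have pvw: "proj v \<noteq> proj w" using assms v w by simp
  obtain S where S: "S > 0" "v - S *\<^sub>R w \<in> closure C" "v - S *\<^sub>R w \<notin> C"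
    using ray_exit[OF C(3) w(1)] .
  obtain R where R: "R > 0" "w - R *\<^sub>R v \<in> closure C" "w - R *\<^sub>R v \<notin> C"
    using ray_exit[OF w(1) C(3)] .
  define a where "a = v - S *\<^sub>R w"
  define b where "b = w - R *\<^sub>R v"
  obtain f g :: "real ^ 'm \<Rightarrow> real"
    where fg: "linear f" "linear g" "f v = 1" "f w = 0" "g v = 0" "g w = 1"
    using dual_pair[OF pvw v(1) w0] .
  note lin = linear_add[OF fg(1)] linear_add[OF fg(2)] linear_scale[OF fg(1)] linear_scale[OF fg(2)]
    linear_diff[OF fg(1)] linear_diff[OF fg(2)] linear_0[OF fg(1)] linear_0[OF fg(2)]
  have fgab: "f a = 1" "g a = - S" "f b = - R" "g b = 1"
    by (auto simp: a_def b_def lin fg)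
  have a0: "a \<noteq> 0" and b0: "b \<noteq> 0" using fgab lin by force+
  have Sb: "a + S *\<^sub>R b = (1 - R * S) *\<^sub>R v" and Ra: "R *\<^sub>R a + b = (1 - R * S) *\<^sub>R w"
    by (simp_all add: a_def b_def algebra_simps)
  \<comment> \<open>The vector \<open>a + S *\<^sub>R b = (1 - R * S) *\<^sub>R v\<close> lies in
    the closure of \<open>C\<close>. For \<open>R * S > 1\<close> it is a negative multiple of
    \<open>v\<close>; for \<open>R * S = 1\<close> both \<open>a\<close> and \<open>- a\<close>
    would be in the closure.\<close>
  have RS: "R * S < 1"
  proof (rule ccontr)
    assume "\<not> ?thesis"
    then consider "R * S = 1" | "R * S > 1" by linarith
    then show False
    proof cases
      case 1
      then have "- a = S *\<^sub>R b" using Sb by (simp add: eq_neg_iff_add_eq_0 neg_eq_iff_add_eq_0)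
      then have "- a \<in> closure C" using scale_closure_C R S by (simp add: b_def)
      then show False using closure_C_salient[of a] S C a0 by (auto simp: a_def)
    next
      case 2
      have "(1/2) *\<^sub>R (2 *\<^sub>R a) + (1/2) *\<^sub>R (2 *\<^sub>R (S *\<^sub>R b)) \<in> closure C"
        using S R by (intro convexD[OF convex_closure[OF convex_C]] scale_closure_C)
          (auto simp: a_def b_def)
      then have "- ((R * S - 1) *\<^sub>R v) \<in> closure C" using Sb by (simp add: algebra_simps)
      then show False
        using minus_notin_closure_C[OF scale_C[OF C(3), of "R * S - 1"]] 2 by simp
    qed
  qed
  have pab: "proj a \<noteq> proj b"
  proof
    assume "proj a = proj b"
    then obtain k where k: "a = k *\<^sub>R b" using a0 b0 by (auto elim: proj_eqD)
    have "1 = - (k * R)" "- S = k"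
      using arg_cong[OF k, of f] arg_cong[OF k, of g] fgab by (auto simp: lin)
    then show False using RS by (auto simp: mult.commute)
  qed
  obtain fa ga :: "real ^ 'm \<Rightarrow> real"
    where fga: "linear fa" "linear ga" "fa a = 1" "fa b = 0" "ga a = 0" "ga b = 1"
    using dual_pair[OF pab a0 b0] .
  note lina = linear_add[OF fga(1)] linear_add[OF fga(2)] linear_scale[OF fga(1)] linear_scale[OF fga(2)]
  have aSb: "a + S *\<^sub>R b \<in> C" and Rab: "R *\<^sub>R a + b \<in> C"
    using Sb Ra scale_C[OF C(3)] scale_C[OF w(1)] RS by simp_all
  have sector_ab: "s *\<^sub>R a + t *\<^sub>R b \<in> C" if "s > 0" "t > 0" for s t
    using sector[of a "S *\<^sub>R b" s "t / S"] scale_closure_C S R aSb that by (simp add: a_def b_def)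
  have fr: "line_through a b \<inter> frontier \<Omega> = {proj a, proj b}"
    using frontier_on_line[of a b] sector_ab[of 1 1] S R a0 b0 by (simp add: a_def b_def)
  have px: "x = proj (a + S *\<^sub>R b)" and py: "y = proj (R *\<^sub>R a + b)"
    using v w RS by (simp_all add: Sb Ra proj_scaleR)
  \<comment> \<open>In terms of \<open>p = S *\<^sub>R b\<close>, the point \<open>x\<close> lies
    over \<open>p + a\<close>, and \<open>R *\<^sub>R a + b\<close> over \<open>y\<close> rescales
    to \<open>(1 / (R * S)) *\<^sub>R p + a\<close>. The cross-ratio is therefore
    \<open>1 / (R * S)\<close>, and \<open>T\<close> is half its logarithm.\<close>
  define T where "T = - ln (R * S) / 2"
  have RS0: "R * S > 0" using R S by simp
  have T: "T > 0" "exp (2 * T) = 1 / (R * S)"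
    using RS RS0 by (simp_all add: T_def exp_minus inverse_eq_divide)
  define p where "p = S *\<^sub>R b"
  have p0: "p \<noteq> 0" using b0 S by (simp add: p_def)
  have projp: "proj p = proj b" using S by (simp add: p_def proj_scaleR)
  have py': "y = proj (exp (2 * T) *\<^sub>R p + a)"
  proof -
    have "exp (2 * T) *\<^sub>R p + a = (1 / R) *\<^sub>R (R *\<^sub>R a + b)"
      using R S unfolding T(2) p_def by (simp add: scaleR_add_right)
    then show ?thesis using R py by (simp add: proj_scaleR)
  qed
  have px': "x = proj (p + a)" using px by (simp add: p_def add.commute)
  have anotin: "a \<notin> cone \<Omega>"
    using S minus_notin_closure_C[of "-a"] by (auto simp: cone_iff a_def)
  have cr: "cross_ratio (proj a) x (proj b) y = exp (2 * T)"
    unfolding px' py' projp[symmetric] by (rule cross_ratio_eq) (use p0 a0 pab projp in auto)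
  have btw: "between_in \<Omega> (proj a) x y"
    unfolding between_in_def
  proof (intro exI conjI allI impI)
    show "proj a \<noteq> proj (R *\<^sub>R a + b)"
    proof
      assume "proj a = proj (R *\<^sub>R a + b)"
      then have "proj a \<in> \<Omega>" using py assms by simp
      then show False using anotin a0 by (simp add: cone_def)
    qed
    show "R *\<^sub>R a + b \<noteq> 0" using Rab C by auto
    show "proj (s *\<^sub>R a + t *\<^sub>R (R *\<^sub>R a + b)) \<in> \<Omega>" if "s > 0" "t > 0" for s t
    proof -
      have "s *\<^sub>R a + t *\<^sub>R (R *\<^sub>R a + b) = (s + t * R) *\<^sub>R a + t *\<^sub>R b" by (simp add: algebra_simps)
      also have "\<dots> \<in> C" using that R by (intro sector_ab) (auto intro: add_pos_pos)
      finally show ?thesis using cone_iff unfolding cone_def by blast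
    qed
    have "(1 - R * S) *\<^sub>R a + S *\<^sub>R (R *\<^sub>R a + b) = a + S *\<^sub>R b" by (simp add: algebra_simps)
    then show "x = proj ((1 - R * S) *\<^sub>R a + S *\<^sub>R (R *\<^sub>R a + b))" using px by simp
  qed (use a0 py RS S in auto)
  \<comment> \<open>The frontier determines the endpoints only as an unordered pair. Excluding the
    reversed labelling makes the \<open>THE\<close> in \<open>hilbert_dist\<close>
    unambiguous.\<close>
  have nbtw: "\<not> between_in \<Omega> (proj b) x y"
  proof
    assume "between_in \<Omega> (proj b) x y"
    then obtain u z s t where h: "u \<noteq> 0" "z \<noteq> 0" "proj u = proj b" "proj z = proj (R *\<^sub>R a + b)"
      "\<And>s t. s > 0 \<Longrightarrow> t > 0 \<Longrightarrow> proj (s *\<^sub>R u + t *\<^sub>R z) \<in> \<Omega>"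
      "s > 0" "t > 0" "proj (a + S *\<^sub>R b) = proj (s *\<^sub>R u + t *\<^sub>R z)"
      unfolding between_in_def px[symmetric] py[symmetric] by metis
    obtain l where l: "l \<noteq> 0" "u = l *\<^sub>R b" using h b0 by (auto elim: proj_eqD)
    have "R *\<^sub>R a + b \<noteq> 0" "a + S *\<^sub>R b \<noteq> 0" using Rab aSb C by auto
    then obtain m where m: "m \<noteq> 0" "z = m *\<^sub>R (R *\<^sub>R a + b)" using h by (auto elim: proj_eqD)
    have comb: "s' *\<^sub>R u + t' *\<^sub>R z = (t' * m * R) *\<^sub>R a + (s' * l + t' * m) *\<^sub>R b" for s' t'
      by (simp add: l m algebra_simps)
    have comb0: "s *\<^sub>R u + t *\<^sub>R z \<noteq> 0"
    proof
      assume "s *\<^sub>R u + t *\<^sub>R z = 0"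
      then have "fa ((t * m * R) *\<^sub>R a + (s * l + t * m) *\<^sub>R b) = 0"
        unfolding comb by (simp add: linear_0[OF fga(1)])
      then show False using h m R by (simp add: lina fga)
    qed
    obtain k where k: "s *\<^sub>R u + t *\<^sub>R z = k *\<^sub>R (a + S *\<^sub>R b)"
      using proj_eqD[OF h(8)[symmetric] comb0] \<open>a + S *\<^sub>R b \<noteq> 0\<close> by auto
    have "t * m * R = k" "s * l + t * m = k * S"
      using arg_cong[OF k[unfolded comb], of fa] arg_cong[OF k[unfolded comb], of ga]
      by (auto simp: lina fga)
    then have sl: "s * l = - (t * m * (1 - R * S))" by (auto simp: algebra_simps)
    \<comment> \<open>With opposite signs, a suitable positive combination of \<open>u\<close> and
      \<open>z\<close> has no \<open>b\<close> component: the alleged segment in \<Omega> runs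
      through the boundary point \<open>proj a\<close>.\<close>
    have "l * m < 0"
    proof -
      have "s * (l * m) = - (t * (1 - R * S) * m^2)" using arg_cong[OF sl, of "\<lambda>x. x * m"] by (simp add: power2_eq_square algebra_simps)
      also have "\<dots> < 0" using h RS m by simp
      finally show ?thesis using h by (simp add: mult_less_0_iff)
    qed
    then have "\<bar>m\<bar> * l + \<bar>l\<bar> * m = 0" by (auto simp: mult_less_0_iff)
    then have "\<bar>m\<bar> *\<^sub>R u + \<bar>l\<bar> *\<^sub>R z = (\<bar>l\<bar> * m * R) *\<^sub>R a" unfolding comb by simp
    moreover have "proj (\<bar>m\<bar> *\<^sub>R u + \<bar>l\<bar> *\<^sub>R z) \<in> \<Omega>" using h l m by simp
    ultimately have "proj a \<in> \<Omega>" using l m R by (simp add: proj_scaleR)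
    then show False using anotin a0 by (simp add: cone_def)
  qed
  have lt: "line_through a b = line_through v w"
  proof (rule proj_line_unique[OF pvw v(1) w0 proj_line_through[OF pab a0 b0]])
    show "proj v \<in> line_through a b" "proj w \<in> line_through a b"
      using px py v w aSb Rab C(5)
      by (metis proj_in_line_through scaleR_one)+
  qed
  have "hilbert_dist \<Omega> x y = T"
    unfolding hilbert_dist_def if_not_P[OF assms(3)]
  proof (rule the_equality)
    show "\<exists>l a b. proj_line l \<and> x \<in> l \<and> y \<in> l \<and> a \<noteq> b \<and> l \<inter> frontier \<Omega> = {a, b} \<and>
       between_in \<Omega> a x y \<and> T = 1 / 2 * ln \<bar>cross_ratio a x b y\<bar>"
      using fr btw pab cr proj_line_through[OF pab a0 b0] lt proj_line_through_basis[OF v(1) w0] v w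
      by (intro exI[of _ "line_through a b"] exI[of _ "proj a"] exI[of _ "proj b"]) auto
  next
    fix d assume "\<exists>l a b. proj_line l \<and> x \<in> l \<and> y \<in> l \<and> a \<noteq> b \<and> l \<inter> frontier \<Omega> = {a, b} \<and>
       between_in \<Omega> a x y \<and> d = 1 / 2 * ln \<bar>cross_ratio a x b y\<bar>"
    then obtain l a' b' where h: "proj_line l" "x \<in> l" "y \<in> l" "a' \<noteq> b'" "l \<inter> frontier \<Omega> = {a', b'}"
      "between_in \<Omega> a' x y" "d = 1 / 2 * ln \<bar>cross_ratio a' x b' y\<bar>" by blast
    have "l = line_through a b" unfolding lt
      using proj_line_unique[OF pvw v(1) w0 h(1)] h v w by simp
    then have "{a', b'} = {proj a, proj b}" using h fr by simp
    moreover have "a' \<noteq> proj b" using h nbtw by blast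
    ultimately have "a' = proj a" "b' = proj b" using h(4) by (auto simp: doubleton_eq_iff)
    then show "d = T" using h cr by simp
  qed
  moreover have "s *\<^sub>R p + t *\<^sub>R a \<in> cone \<Omega>" if "s > 0" "t > 0" for s t
    using sector_ab[of t "s * S"] that S by (simp add: p_def cone_iff add.commute)
  ultimately show ?thesis
    using that[of p a T] p0 a0 pab projp T px' py' by auto
qed

end


section \<open>Calculus\<close>

text \<open>Comparison with \<open>f'' = f\<close>: if \<open>f' + f\<close> had a zero \<open>t\<^sub>0\<close>, then \<open>e\<^sup>-\<^sup>t (f' + f)\<close>, which is strictly
  decreasing, would be bounded away from zero after \<open>t\<^sub>0 + 1\<close>, and \<open>e\<^sup>t f\<close> would tend to \<open>-\<infinity>\<close>.\<close>

lemma deriv_gt_minus_self: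
  fixes f :: "real \<Rightarrow> real"
  assumes f: "\<And>t. (f has_real_derivative f1 t) (at t)" "\<And>t. (f1 has_real_derivative f2 t) (at t)"
    and pos: "\<And>t. f t > 0" and less: "\<And>t. f2 t < f t"
  shows "f1 t0 + f t0 > 0"
proof (rule ccontr)
  assume neg: "\<not> ?thesis"
  define G where "G t = exp (- t) * (f1 t + f t)" for t
  have G: "(G has_real_derivative exp (- t) * (f2 t - f t)) (at t)" for t
    unfolding G_def by (auto intro!: derivative_eq_intros f simp: algebra_simps)
  have dec: "G b < G a" if "a < b" for a b
    using that by (rule DERIV_neg_imp_decreasing) (use G less in \<open>auto simp: mult_pos_neg intro!: exI\<close>)
  \<comment> \<open>At \<open>t0\<close> only \<open>G t0 \<le> 0\<close> is known; strict decrease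
    makes \<open>G\<close> negative one unit later.\<close>
  define t1 where "t1 = t0 + 1"
  define d where "d = - G t1"
  have "G t0 \<le> 0" using neg by (simp add: G_def mult_le_0_iff)
  then have d: "d > 0" using dec[of t0 t1] by (simp add: d_def t1_def)
  \<comment> \<open>The derivative of \<open>exp t * f t\<close> is
    \<open>exp (2 * t) * G t\<close>, at most \<open>- d * exp (2 * t)\<close> after
    \<open>t1\<close>. The second term compensates exactly this bound, so \<open>F\<close> is
    nonincreasing there.\<close>
  define F where "F t = exp t * f t + d * exp (2 * t) / 2" for t
  have F: "(F has_real_derivative exp (2 * t) * (G t + d)) (at t)" for t
    unfolding F_def by (auto intro!: derivative_eq_intros f simp: algebra_simps G_def exp_add[symmetric] exp_minus_inverse)
  have Fle: "F t \<le> F t1" if "t1 \<le> t" for t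
  proof (rule DERIV_nonpos_imp_nonincreasing[OF that])
    fix s assume "t1 \<le> s" "s \<le> t"
    then have "G s \<le> G t1" using dec[of t1 s] by (cases "s = t1") auto
    then have "exp (2 * s) * (G s + d) \<le> 0" by (simp add: d_def mult_le_0_iff)
    then show "\<exists>y. (F has_real_derivative y) (at s) \<and> y \<le> 0" using F by blast
  qed
  \<comment> \<open>Chosen so that \<open>d * t\<close> already reaches \<open>F t1\<close>; since
    \<open>exp (2 * t) > 2 * t\<close>, the second term of \<open>F t\<close> alone exceeds
    \<open>F t1\<close>.\<close>
  define t where "t = max t1 (F t1 / d)"
  have "d * exp (2 * t) / 2 > d * t"
    using mult_strict_left_mono[OF less_le_trans[OF _ exp_ge_add_one_self[of "2 * t"]], of "2 * t" d] d
    by simp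
  moreover have "d * t \<ge> F t1" using d by (simp add: t_def max_def field_simps)
  moreover have "exp t * f t > 0" using pos by simp
  ultimately have "F t > F t1" unfolding F_def[of t] by linarith
  moreover have "t1 \<le> t" by (simp add: t_def)
  ultimately show False using Fle[of t] by simp
qed

text \<open>The comparison lemma, applied to \<open>f\<close> and to its time reversal, gives both
  bounds for positive \<open>f\<close>. A nonvanishing continuous \<open>f\<close> has constant
  sign, and the negative case passes to \<open>- f\<close>.\<close>

lemma abs_deriv_less:
  fixes f :: "real \<Rightarrow> real"
  assumes f: "\<And>t. (f has_real_derivative f1 t) (at t)" "\<And>t. (f1 has_real_derivative f2 t) (at t)"
    and nz: "\<And>t. f t \<noteq> 0" and less: "\<And>t. f2 t / f t < 1"
  shows "\<bar>f1 t / f t\<bar> < 1"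
proof -
  have pos_case: "\<bar>g1 t / g t\<bar> < 1"
    if g: "\<And>t. (g has_real_derivative g1 t) (at t)" "\<And>t. (g1 has_real_derivative g2 t) (at t)"
      and pos: "\<And>t. g t > 0" and less: "\<And>t. g2 t / g t < 1" for g g1 g2 :: "real \<Rightarrow> real"
  proof -
    have less': "g2 t < g t" for t using less[of t] pos[of t] by (simp add: field_simps)
    have "g1 t + g t > 0" using deriv_gt_minus_self[OF g pos less'] .
    moreover have "- g1 t + g t > 0"
    proof -
      have 1: "((\<lambda>t. g (- t)) has_real_derivative - g1 (- t)) (at t)" for t
        using DERIV_chain'[OF DERIV_minus[OF DERIV_ident] g(1)[of "-t"]] by simp
      have 2: "((\<lambda>t. - g1 (- t)) has_real_derivative g2 (- t)) (at t)" for t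
        using DERIV_minus[OF DERIV_chain'[OF DERIV_minus[OF DERIV_ident] g(2)[of "-t"]]] by simp
      show ?thesis using deriv_gt_minus_self[OF 1 2 pos less', of "- t"] by simp
    qed
    ultimately have "\<bar>g1 t\<bar> < g t" by linarith
    then show ?thesis using pos[of t] by (simp add: abs_divide)
  qed
  have cont: "continuous_on UNIV f" using f(1) by (meson DERIV_continuous_on has_field_derivative_at_within)
  have "(\<forall>t. f t > 0) \<or> (\<forall>t. f t < 0)"
  proof (rule ccontr)
    assume "\<not> ?thesis"
    then obtain a b where "f a < 0" "f b > 0" using nz by (metis linorder_neqE_linordered_idom)
    then have "0 \<in> f ` UNIV"
      using connected_continuous_image[OF cont connected_UNIV]
      by (meson connectedD_interval less_imp_le rangeI)
    then show False using nz by auto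
  qed
  then show ?thesis
  proof
    assume "\<forall>t. f t > 0" then show ?thesis using pos_case[OF f] less by blast
  next
    assume "\<forall>t. f t < 0"
    then have p: "- f t > 0" for t by auto
    have "\<bar>- f1 t / - f t\<bar> < 1"
      by (rule pos_case[OF DERIV_minus[OF f(1)] DERIV_minus[OF f(2)] p]) (use less in simp)
    then show ?thesis by simp
  qed
qed

text \<open>With \<open>r = f1 / f\<close> one has \<open>r' = f2 / f - r\<^sup>2\<close>, so the
  integrand is at most \<open>T - T * r' / 2\<close>, which has the explicit primitive
  \<open>P\<close>. The bounds on \<open>r\<close> at the two ends make the boundary terms
  contribute less than 1.\<close>

lemma integral_sqrt_le:
  fixes f :: "real \<Rightarrow> real"
  assumes f: "\<And>t. (f has_real_derivative f1 t) (at t)" "\<And>t. (f1 has_real_derivative f2 t) (at t)"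
    and nz: "\<And>t. f t \<noteq> 0" and less: "\<And>t. f2 t / f t < 1" and T: "T > 0"
  shows "integral {0..1} (\<lambda>s. sqrt (T\<^sup>2 * (1 - f2 (s * T) / f (s * T)))) < T + 1"
proof (cases "(\<lambda>s. sqrt (T\<^sup>2 * (1 - f2 (s * T) / f (s * T)))) integrable_on {0..1}")
  \<comment> \<open>A non-integrable function has integral 0 by convention.\<close>
  case False
  then show ?thesis using T by (simp add: not_integrable_integral)
next
  case True
  define r where "r t = f1 t / f t" for t
  have r: "(r has_real_derivative f2 t / f t - (r t)\<^sup>2) (at t)" for t
    unfolding r_def using nz[of t]
    by (auto intro!: derivative_eq_intros f simp: power2_eq_square field_simps)
  define P where "P s = s * T - r (s * T) / 2" for s
  have P: "(P has_real_derivative T - T * (f2 (s * T) / f (s * T) - (r (s * T))\<^sup>2) / 2) (at s)" for s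
  proof -
    have "((\<lambda>s. r (s * T)) has_real_derivative (f2 (s * T) / f (s * T) - (r (s * T))\<^sup>2) * T) (at s)"
      by (rule DERIV_chain'[OF _ r]) (auto intro!: derivative_eq_intros)
    then show ?thesis unfolding P_def
      by (rule DERIV_cong[OF DERIV_diff[OF DERIV_cmult_right[OF DERIV_ident] DERIV_cdivide]]) simp
  qed
  have I: "((\<lambda>s. T - T * (f2 (s * T) / f (s * T) - (r (s * T))\<^sup>2) / 2) has_integral P 1 - P 0) {0..1}"
    by (rule fundamental_theorem_of_calculus)
      (auto intro: has_field_derivative_at_within P simp flip: has_real_derivative_iff_has_vector_derivative)
  have "integral {0..1} (\<lambda>s. sqrt (T\<^sup>2 * (1 - f2 (s * T) / f (s * T)))) \<le> P 1 - P 0"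
  proof (rule has_integral_le[OF integrable_integral[OF True] I])
    fix s :: real
    define u where "u = f2 (s * T) / f (s * T)"
    \<comment> \<open>Arithmetic-geometric mean inequality for 1 and \<open>1 - u\<close>.\<close>
    have "sqrt (1 - u) \<le> 1 - u / 2"
      using arith_geo_mean_sqrt[of 1 "1 - u"] less[of "s * T"] by (simp add: u_def field_simps)
    also have "\<dots> \<le> 1 - (u - (r (s * T))\<^sup>2) / 2" by simp
    finally have "T * sqrt (1 - u) \<le> T * (1 - (u - (r (s * T))\<^sup>2) / 2)" using T by simp
    then show "sqrt (T\<^sup>2 * (1 - f2 (s * T) / f (s * T))) \<le> T - T * (f2 (s * T) / f (s * T) - (r (s * T))\<^sup>2) / 2"
      using T unfolding real_sqrt_mult u_def by (simp add: algebra_simps)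
  qed
  also have "P 1 - P 0 < T + 1"
    using abs_deriv_less[OF f nz less, of T] abs_deriv_less[OF f nz less, of 0]
    unfolding P_def r_def by (simp del: abs_divide)
  finally show ?thesis .
qed

section \<open>Smooth maps on open sets, linear fields and the chain rule along curves\<close>

lemma smooth_on_differentiable:
  fixes F :: "real ^ 'm::finite \<Rightarrow> real ^ 'm"
  assumes "open W" "smooth_on W F" "v \<in> W" "linear M"
  shows "F differentiable (at v)"
    "(\<lambda>w. frechet_derivative F (at w) (M w)) differentiable (at v)"
proof -
  have C1: "Ck_on (Suc k) W F" for k using assms(2) by (auto simp only: smooth_on_def)
  have diff: "F differentiable (at w)" if "w \<in> W" for w using C1[of 0] that by simp
  show "F differentiable (at v)" using diff assms by blast
  have d2: "(\<lambda>w. frechet_derivative F (at w) a) differentiable (at v)" for a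
    using C1[of 1] assms(3) by simp
  have bM: "bounded_linear (\<lambda>w. M w $ i)" for i
    using assms(4) by (intro bounded_linear_compose[OF bounded_linear_vec_nth]) (simp add: linear_conv_bounded_linear)
  have dM: "(\<lambda>w. M w $ i) differentiable (at v)" for i
    using bounded_linear_imp_differentiable[OF bM] .
  \<comment> \<open>\<open>Ck_on\<close> controls derivatives in constant directions only, so the
    moving direction \<open>M w\<close> is expanded in the standard basis.\<close>
  have "(\<lambda>w. \<Sum>i\<in>UNIV. (M w $ i) *\<^sub>R frechet_derivative F (at w) (axis i 1)) differentiable (at v)"
    by (intro differentiable_sum differentiable_scaleR d2 dM ballI) auto
  moreover have "(\<Sum>i\<in>UNIV. (M w $ i) *\<^sub>R frechet_derivative F (at w) (axis i 1)) = frechet_derivative F (at w) (M w)"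
    if "w \<in> W" for w
  proof -
    have l: "linear (frechet_derivative F (at w))" using linear_frechet_derivative[OF diff[OF that]] .
    have "M w = (\<Sum>i\<in>UNIV. (M w $ i) *\<^sub>R axis i 1)" using basis_expansion[of "M w"]
      by (simp add: scalar_mult_eq_scaleR)
    then have "frechet_derivative F (at w) (M w) =
        frechet_derivative F (at w) (\<Sum>i\<in>UNIV. (M w $ i) *\<^sub>R axis i 1)" by simp
    also have "\<dots> = (\<Sum>i\<in>UNIV. (M w $ i) *\<^sub>R frechet_derivative F (at w) (axis i 1))"
      by (simp add: linear_sum[OF l] linear_scale[OF l])
    finally show ?thesis by simp
  qed
  ultimately show "(\<lambda>w. frechet_derivative F (at w) (M w)) differentiable (at v)"
    unfolding differentiable_def by (blast intro: has_derivative_transform_within_open[OF _ assms(1,3)])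
qed

lemma Ck_on_const: "Ck_on k S (\<lambda>x. c)"
  by (induction k arbitrary: c) auto

text \<open>Linear maps are homogeneous of degree one, as lifts of vector fields must be. This
  supplies a field extending the velocity of a chord.\<close>

lemma vector_field_linear:
  fixes M :: "real ^ 'm::finite \<Rightarrow> real ^ 'm"
  assumes "linear M"
  shows "vector_field \<Omega> M"
proof -
  have b: "bounded_linear M" using assms by (simp add: linear_conv_bounded_linear)
  have fd: "frechet_derivative M (at x) = M" for x
    using frechet_derivative_at[OF bounded_linear_imp_has_derivative[OF b]] by simp
  have "Ck_on k (cone \<Omega>) M" for k
    by (cases k) (auto simp: fd Ck_on_const bounded_linear_imp_differentiable[OF b] linear_continuous_on[OF b])
  then show ?thesis using assms by (simp add: vector_field_def smooth_on_def linear_scale)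
qed

lemma has_vector_derivative_comp_frechet:
  assumes "(c has_vector_derivative c') (at t)" "F differentiable (at (c t))"
  shows "((\<lambda>s. F (c s)) has_vector_derivative frechet_derivative F (at (c t)) c') (at t)"
proof -
  have "(F has_derivative frechet_derivative F (at (c t))) (at (c t) within range c)"
    by (rule has_derivative_at_withinI) (rule frechet_derivative_works[THEN iffD1, OF assms(2)])
  from vector_derivative_diff_chain_within[OF assms(1) this] show ?thesis by (simp add: o_def)
qed


section \<open>The Blaschke metric along a chord\<close>

locale affine_sphere =
  fixes \<Omega> :: "'m::finite rp set" and k :: real and \<xi> :: "'m rp \<Rightarrow> real ^ 'm" and h :: "'m tensor2"
  assumes open_dom: "open \<Omega>" and sphere: "hyperbolic_affine_sphere k \<Omega> \<xi> h"
begin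

lemma extension:
  assumes "v \<in> cone \<Omega>"
  obtains g where "extends_metric \<xi> h v g"
  using sphere assms unfolding hyperbolic_affine_sphere_def by blast

lemma bilinear_h: "v \<in> cone \<Omega> \<Longrightarrow> bilinear (h v)"
  using sphere unfolding hyperbolic_affine_sphere_def second_form_def by blast

lemma section_smooth: "smooth_on (cone \<Omega>) (\<xi> \<circ> proj)"
  and section_in_line: "x \<in> \<Omega> \<Longrightarrow> \<xi> x \<in> line_of x"
  and section_nonzero: "x \<in> \<Omega> \<Longrightarrow> \<xi> x \<noteq> 0"
  using sphere unfolding hyperbolic_affine_sphere_def nonvanishing_section_def by blast+

lemma h_pos: "v \<in> cone \<Omega> \<Longrightarrow> A \<notin> span {v} \<Longrightarrow> h v A A > 0"
  using sphere unfolding hyperbolic_affine_sphere_def strictly_convex_def by blast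

text \<open>The section composed with \<open>proj\<close> is constant along the open ray through
  \<open>v\<close>.\<close>

lemma dsec_radial:
  assumes "v \<in> cone \<Omega>"
  shows "dsec \<xi> v v = 0"
proof -
  have "((\<lambda>s. s *\<^sub>R v) has_vector_derivative v) (at 1)"
    by (auto intro!: derivative_eq_intros)
  moreover have "(\<xi> \<circ> proj) differentiable (at (1 *\<^sub>R v))"
    using smooth_on_differentiable(1)[OF open_cone[OF open_dom] section_smooth assms linear_id] by simp
  ultimately have 1: "((\<lambda>s. (\<xi> \<circ> proj) (s *\<^sub>R v)) has_vector_derivative dsec \<xi> v v) (at 1)"
    using has_vector_derivative_comp_frechet[of "\<lambda>s. s *\<^sub>R v" v 1 "\<xi> \<circ> proj"] by (simp add: dsec_def)
  have "((\<lambda>s. (\<xi> \<circ> proj) (s *\<^sub>R v)) has_vector_derivative 0) (at 1)"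
    by (rule has_vector_derivative_transform_within_open[of "\<lambda>s. \<xi> (proj v)" _ _ "{0<..}"])
      (auto simp: proj_scaleR)
  then show ?thesis using vector_derivative_unique_at[OF 1] by simp
qed

text \<open>Strict convexity speaks of non-radial directions; in the radial direction
  \<open>h\<close> vanishes because \<open>dsec\<close> does.\<close>

lemma h_nonneg:
  assumes "v \<in> cone \<Omega>"
  shows "h v A A \<ge> 0"
proof (cases "A \<in> span {v}")
  case True
  then obtain c where c: "A = c *\<^sub>R v" by (auto simp: span_singleton)
  obtain g where g: "extends_metric \<xi> h v g" using extension[OF assms] .
  then have "h v v v = g (dsec \<xi> v v) (dsec \<xi> v v)" by (simp add: extends_metric_def)
  also have "\<dots> = 0" using g by (simp add: dsec_radial[OF assms] extends_metric_def bilinear_lzero)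
  finally show ?thesis
    using bilinear_h[OF assms] by (simp add: c bilinear_lmul bilinear_rmul)
qed (use h_pos[OF assms] in \<open>simp add: less_imp_le\<close>)

text \<open>Bounds the set of lengths below, so that its infimum is at most each length.
  Nonnegativity of \<open>h\<close> matters because \<open>sqrt\<close> is negative on negative
  reals.\<close>

lemma curve_length_nonneg:
  assumes "c ` {0..1} \<subseteq> cone \<Omega>"
  shows "curve_length h c \<ge> 0"
proof -
  let ?f = "\<lambda>t. sqrt (h (c t) (vector_derivative c (at t)) (vector_derivative c (at t)))"
  have "?f t \<ge> 0" if "t \<in> {0..1}" for t using assms that h_nonneg[of "c t"] by (auto simp: image_subset_iff)
  then show ?thesis unfolding curve_length_def
    by (cases "?f integrable_on {0..1}") (auto intro: integral_nonneg simp: not_integrable_integral)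
qed

lemma riemannian_dist_le:
  assumes "c C1_differentiable_on {0..1}" "c ` {0..1} \<subseteq> cone \<Omega>"
  shows "riemannian_dist \<Omega> h (proj (c 0)) (proj (c 1)) \<le> curve_length h c"
  unfolding riemannian_dist_def
proof (rule cInf_lower)
  show "bdd_below {curve_length h c' | c'. c' C1_differentiable_on {0..1} \<and> c' ` {0..1} \<subseteq> cone \<Omega> \<and>
      proj (c' 0) = proj (c 0) \<and> proj (c' 1) = proj (c 1)}"
    using curve_length_nonneg by (intro bdd_belowI[of _ 0]) auto
qed (use assms in blast)

text \<open>Write \<open>e = \<psi> \<gamma>\<close> for the path \<open>\<gamma>\<close> of the affine sphere over the chord
  \<open>e\<^sub>t = e\<^sup>t p + e\<^sup>-\<^sup>t q\<close>. Since \<open>e'' = e\<close>, the component of \<open>\<psi>'' \<gamma> + 2 \<psi>' \<gamma>' + \<psi> \<gamma>'' = e\<close> along \<open>\<gamma>\<close>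
  in the splitting \<open>T\<Omega> \<oplus> L\<close> reads \<open>\<psi>'' + \<psi> h(e', e') = \<psi>\<close>.\<close>

lemma h_on_chord:
  fixes p q :: "real ^ 'm"
  defines "e \<equiv> \<lambda>t. exp t *\<^sub>R p + exp (- t) *\<^sub>R q" and "e1 \<equiv> \<lambda>t. exp t *\<^sub>R p - exp (- t) *\<^sub>R q"
  assumes pq: "p \<noteq> 0" "q \<noteq> 0" "proj p \<noteq> proj q"
    and chord: "\<And>t. e t \<in> cone \<Omega>"
  obtains \<psi> \<psi>1 \<psi>2 :: "real \<Rightarrow> real"
  where "\<And>t. (\<psi> has_real_derivative \<psi>1 t) (at t)" "\<And>t. (\<psi>1 has_real_derivative \<psi>2 t) (at t)"
    "\<And>t. \<psi> t \<noteq> 0" "\<And>t. \<psi>2 t / \<psi> t < 1" "\<And>t. h (e t) (e1 t) (e1 t) = 1 - \<psi>2 t / \<psi> t"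
proof -
  obtain fp fq :: "real ^ 'm \<Rightarrow> real"
    where f: "linear fp" "linear fq" "fp p = 1" "fp q = 0" "fq p = 0" "fq q = 1"
    using dual_pair[OF pq(3,1,2)] .
  note lin = linear_add[OF f(1)] linear_add[OF f(2)] linear_diff[OF f(1)] linear_diff[OF f(2)]
    linear_scale[OF f(1)] linear_scale[OF f(2)]
  have e: "(e has_vector_derivative e1 t) (at t)" and e1: "(e1 has_vector_derivative e t) (at t)" for t
    unfolding e_def e1_def by (auto intro!: derivative_eq_intros)
  \<comment> \<open>A linear field with value \<open>e1 t\<close> at \<open>e t\<close>, so that the
    chord velocity is the restriction of a field to which \<open>second_form\<close>
    applies.\<close>
  define M where "M z = fp z *\<^sub>R p - fq z *\<^sub>R q" for z
  have M: "linear M" unfolding M_def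
    by (rule linearI) (simp_all add: lin algebra_simps)
  have Me: "M (e t) = e1 t" for t by (simp add: M_def e_def e1_def lin f)
  define \<gamma> where "\<gamma> t = (\<xi> \<circ> proj) (e t)" for t
  define G where "G w = dsec \<xi> w (M w)" for w
  define \<gamma>1 where "\<gamma>1 t = G (e t)" for t
  define \<gamma>2 where "\<gamma>2 t = frechet_derivative G (at (e t)) (e1 t)" for t
  note diff = smooth_on_differentiable[OF open_cone[OF open_dom] section_smooth chord M]
  have \<gamma>: "(\<gamma> has_vector_derivative \<gamma>1 t) (at t)" for t
    unfolding \<gamma>_def[abs_def] \<gamma>1_def G_def dsec_def Me
    by (rule has_vector_derivative_comp_frechet[OF e diff(1)])
  have \<gamma>1: "(\<gamma>1 has_vector_derivative \<gamma>2 t) (at t)" for t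
    unfolding \<gamma>1_def[abs_def] \<gamma>2_def G_def[abs_def] dsec_def
    by (rule has_vector_derivative_comp_frechet[OF e diff(2)])
  \<comment> \<open>Since \<gamma> is a multiple of \<open>e\<close> and the \<open>p\<close>
    coordinate of \<open>e t\<close> is \<open>exp t\<close>, the factor \<psi> equals
    \<open>exp t / m t\<close>, which is visibly differentiable.\<close>
  define m where "m t = fp (\<gamma> t)" for t
  have bl: "bounded_linear fp" using f(1) by (simp add: linear_conv_bounded_linear)
  have m: "(m has_real_derivative fp (\<gamma>1 t)) (at t)" for t
    unfolding m_def using bounded_linear.has_vector_derivative[OF bl \<gamma>]
    by (simp add: has_real_derivative_iff_has_vector_derivative)
  have m1: "((\<lambda>t. fp (\<gamma>1 t)) has_real_derivative fp (\<gamma>2 t)) (at t)" for t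
    using bounded_linear.has_vector_derivative[OF bl \<gamma>1]
    by (simp add: has_real_derivative_iff_has_vector_derivative)
  have \<gamma>_line: "\<exists>\<kappa>. \<kappa> \<noteq> 0 \<and> \<gamma> t = \<kappa> *\<^sub>R e t" for t
  proof -
    have "proj (e t) \<in> \<Omega>" "e t \<noteq> 0" using chord[of t] by (auto simp: cone_def)
    then have "\<gamma> t \<in> span {e t}" "\<gamma> t \<noteq> 0"
      using section_in_line section_nonzero by (auto simp: \<gamma>_def line_of_proj[symmetric])
    then show ?thesis by (auto simp: span_singleton)
  qed
  have fpe: "fp (e t) = exp t" for t by (simp add: e_def lin f)
  have m_nz: "m t \<noteq> 0" for t using \<gamma>_line[of t] by (auto simp: m_def lin fpe)
  define \<psi> where "\<psi> t = exp t / m t" for t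
  define \<rho> where "\<rho> t = fp (\<gamma>1 t) / m t" for t
  define \<psi>1 where "\<psi>1 t = \<psi> t * (1 - \<rho> t)" for t
  define \<psi>2 where "\<psi>2 t = \<psi>1 t * (1 - \<rho> t) - \<psi> t * (fp (\<gamma>2 t) / m t - (\<rho> t)\<^sup>2)" for t
  have \<psi>_nz: "\<psi> t \<noteq> 0" for t by (simp add: \<psi>_def m_nz)
  have \<psi>: "(\<psi> has_real_derivative \<psi>1 t) (at t)" for t
    unfolding \<psi>_def \<psi>1_def \<rho>_def using m_nz[of t]
    by (auto intro!: derivative_eq_intros m simp: field_simps)
  have \<rho>: "(\<rho> has_real_derivative fp (\<gamma>2 t) / m t - (\<rho> t)\<^sup>2) (at t)" for t
    unfolding \<rho>_def using m_nz[of t]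
    by (auto intro!: derivative_eq_intros m m1 simp: field_simps power2_eq_square)
  have \<psi>1: "(\<psi>1 has_real_derivative \<psi>2 t) (at t)" for t
    unfolding \<psi>1_def \<psi>2_def
    by (auto intro!: derivative_eq_intros \<psi> \<rho> simp: \<psi>1_def algebra_simps)
  have e_eq: "e t = \<psi> t *\<^sub>R \<gamma> t" for t
    using \<gamma>_line[of t] by (auto simp: \<psi>_def m_def lin fpe)
  have e1_eq: "e1 t = \<psi> t *\<^sub>R \<gamma>1 t + \<psi>1 t *\<^sub>R \<gamma> t" for t
    using vector_derivative_unique_at[OF e]
      has_vector_derivative_scaleR[OF \<psi> \<gamma>] unfolding e_eq[abs_def] by blast
  have e2_eq: "e t = (\<psi> t *\<^sub>R \<gamma>2 t + \<psi>1 t *\<^sub>R \<gamma>1 t) + (\<psi>1 t *\<^sub>R \<gamma>1 t + \<psi>2 t *\<^sub>R \<gamma> t)" for t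
    using vector_derivative_unique_at[OF e1]
      has_vector_derivative_add[OF has_vector_derivative_scaleR[OF \<psi> \<gamma>1] has_vector_derivative_scaleR[OF \<psi>1 \<gamma>]]
    unfolding e1_eq[abs_def] by blast
  have H: "h (e t) (e1 t) (e1 t) = 1 - \<psi>2 t / \<psi> t" for t
  proof -
    obtain g where g: "extends_metric \<xi> h (e t) g" using extension[OF chord] .
    have g': "bilinear g" "g (dsec \<xi> (e t) A) (\<gamma> t) = 0" "g (\<gamma> t) (\<gamma> t) = 1" for A
      using g by (auto simp: extends_metric_def \<gamma>_def)
    note gl = bilinear_ladd[OF g'(1)] bilinear_lmul[OF g'(1)]
    have "second_form \<Omega> \<xi> h" using sphere by (simp add: hyperbolic_affine_sphere_def)
    \<comment> \<open>The defining decomposition for \<open>X = Y = M\<close> at \<open>e t\<close>.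
      Pairing it with \<open>\<gamma> t\<close> under \<open>g\<close> removes the tangential part
      and isolates \<open>h\<close>.\<close>
    then obtain Z where "\<gamma>2 t = dsec \<xi> (e t) Z + h (e t) (e1 t) (e1 t) *\<^sub>R \<gamma> t"
      using vector_field_linear[OF M, of \<Omega>] chord[of t]
      unfolding second_form_def \<gamma>2_def \<gamma>_def G_def Me[symmetric] comp_def by blast
    then have "g (\<gamma>2 t) (\<gamma> t) = h (e t) (e1 t) (e1 t)" by (simp add: gl g')
    moreover have "g (\<gamma>1 t) (\<gamma> t) = 0" by (simp add: \<gamma>1_def G_def g')
    moreover have "g (e t) (\<gamma> t) = \<psi> t" unfolding e_eq by (simp add: gl g')
    ultimately have "\<psi> t = \<psi> t * h (e t) (e1 t) (e1 t) + \<psi>2 t"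
      using arg_cong[OF e2_eq[of t], of "\<lambda>z. g z (\<gamma> t)"] unfolding gl g'(3) by simp
    then show ?thesis using \<psi>_nz[of t] by (simp add: field_simps)
  qed
  have "e1 t \<notin> span {e t}" for t
  proof
    assume "e1 t \<in> span {e t}"
    then obtain c where c: "e1 t = c *\<^sub>R e t" by (auto simp: span_singleton)
    have "exp t = c * exp t" "- exp (- t) = c * exp (- t)"
      using arg_cong[OF c, of fp] arg_cong[OF c, of fq] by (auto simp: e_def e1_def lin f)
    then show False by simp
  qed
  then have "\<psi>2 t / \<psi> t < 1" for t using h_pos[OF chord, of "e1 t" t] H[of t] by simp
  then show ?thesis using that[OF \<psi> \<psi>1 \<psi>_nz _ H] by blast
qed

lemma riemannian_dist_chord:
  assumes pq: "p \<noteq> 0" "q \<noteq> 0" "proj p \<noteq> proj q" and T: "T > 0"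
    and chord: "\<And>s t. s > 0 \<Longrightarrow> t > 0 \<Longrightarrow> s *\<^sub>R p + t *\<^sub>R q \<in> cone \<Omega>"
  shows "riemannian_dist \<Omega> h (proj (p + q)) (proj (exp (2 * T) *\<^sub>R p + q)) < T + 1"
proof -
  define e where "e t = exp t *\<^sub>R p + exp (- t) *\<^sub>R q" for t
  define e1 where "e1 t = exp t *\<^sub>R p - exp (- t) *\<^sub>R q" for t
  have in_cone: "e t \<in> cone \<Omega>" for t unfolding e_def by (intro chord) auto
  obtain \<psi> \<psi>1 \<psi>2 :: "real \<Rightarrow> real"
    where \<psi>: "\<And>t. (\<psi> has_real_derivative \<psi>1 t) (at t)" "\<And>t. (\<psi>1 has_real_derivative \<psi>2 t) (at t)"
      "\<And>t. \<psi> t \<noteq> 0" "\<And>t. \<psi>2 t / \<psi> t < 1" "\<And>t. h (e t) (e1 t) (e1 t) = 1 - \<psi>2 t / \<psi> t"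
    using h_on_chord[OF pq] in_cone unfolding e_def e1_def by blast
  \<comment> \<open>Admissible curves are parametrised by \<open>{0..1}\<close>; the speed
    \<open>T\<close> produces the factor \<open>T\<^sup>2\<close> under the root.\<close>
  define c where "c s = e (s * T)" for s
  have c: "(c has_vector_derivative T *\<^sub>R e1 (s * T)) (at s)" for s
    unfolding c_def e_def e1_def by (auto intro!: derivative_eq_intros simp: algebra_simps)
  have "continuous_on {0..1} (\<lambda>s. T *\<^sub>R e1 (s * T))"
    unfolding e1_def by (intro continuous_intros)
  then have C1: "c C1_differentiable_on {0..1}"
    using c unfolding C1_differentiable_on_def by (intro exI[of _ "\<lambda>s. T *\<^sub>R e1 (s * T)"]) auto
  have "curve_length h c = integral {0..1} (\<lambda>s. sqrt (T\<^sup>2 * (1 - \<psi>2 (s * T) / \<psi> (s * T))))"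
    unfolding curve_length_def vector_derivative_at[OF c]
    using bilinear_h[OF in_cone]
    by (simp add: c_def bilinear_lmul bilinear_rmul \<psi>(5) power2_eq_square mult.assoc)
  also have "\<dots> < T + 1" by (rule integral_sqrt_le[OF \<psi>(1-4) T])
  finally have "curve_length h c < T + 1" .
  moreover have "riemannian_dist \<Omega> h (proj (c 0)) (proj (c 1)) \<le> curve_length h c"
    using riemannian_dist_le[OF C1] in_cone by (auto simp: c_def)
  moreover have "proj (c 0) = proj (p + q)" by (simp add: c_def e_def)
  moreover have "proj (c 1) = proj (exp (2 * T) *\<^sub>R p + q)"
  proof -
    have "exp (2 * T) *\<^sub>R p + q = exp T *\<^sub>R c 1"
      by (simp add: c_def e_def scaleR_add_right flip: exp_add)
    then show ?thesis by (simp add: proj_scaleR)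
  qed
  ultimately show ?thesis by simp
qed

lemma riemannian_dist_self:
  assumes "x \<in> \<Omega>"
  shows "riemannian_dist \<Omega> h x x \<le> 0"
proof -
  obtain v where v: "v \<noteq> 0" "x = proj v" by (rule rp_cases)
  then have "v \<in> cone \<Omega>" using assms by (simp add: cone_def)
  then have "curve_length h (\<lambda>t. v) = 0"
    using bilinear_h by (simp add: curve_length_def bilinear_lzero)
  then show ?thesis using riemannian_dist_le[of "\<lambda>t. v"] \<open>v \<in> cone \<Omega>\<close> v by auto
qed

end

theorem lemmal:
  fixes \<Omega> :: "'m::finite rp set" and h\<^sub>B :: "'m tensor2" and x y :: "'m rp"
  assumes "open \<Omega>" and "convex_rp \<Omega>" and "proper_rp \<Omega>"
    and "blaschke_metric \<Omega> h\<^sub>B"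
    and "x \<in> \<Omega>" and "y \<in> \<Omega>"
  shows "riemannian_dist \<Omega> h\<^sub>B x y < hilbert_dist \<Omega> x y + 1"
proof -
  obtain k \<xi> where "hyperbolic_affine_sphere k \<Omega> \<xi> h\<^sub>B"
    using assms(4) by (auto simp: blaschke_metric_def)
  then interpret affine_sphere \<Omega> k \<xi> h\<^sub>B using assms by unfold_locales
  interpret proper_convex_domain \<Omega> using assms by unfold_locales
  show ?thesis
  proof (cases "x = y")
    \<comment> \<open>There is no chord to use here; the constant curve gives distance at most
      0.\<close>
    case True
    then show ?thesis using riemannian_dist_self[OF assms(5)] by (simp add: hilbert_dist_def)
  next
    case False
    then obtain p q T where pq: "p \<noteq> 0" "q \<noteq> 0" "proj p \<noteq> proj q" "T > 0"
      "\<And>s t. s > 0 \<Longrightarrow> t > 0 \<Longrightarrow> s *\<^sub>R p + t *\<^sub>R q \<in> cone \<Omega>"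
      "x = proj (p + q)" "y = proj (exp (2 * T) *\<^sub>R p + q)" "hilbert_dist \<Omega> x y = T"
      using hilbert_chord[OF assms(5,6)] by metis
    show ?thesis using riemannian_dist_chord[OF pq(1-5)] pq(6-8) by simp
  qed
qed

end
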